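(* Let $\mathcal{A}$ be a central, essential hyperplane arrangement in $V=\mathbb{C}^\ell$. The logarithmic ideal $I=I(\mathcal{A})\subseteq S$ is a complete intersection if and only if $\mathcal{A}$ is free.
   Context: Let $V=\mathbb{C}^\ell$ with coordinate ring $R=\mathbb{C}[x_1,\dots,x_\ell]$. Let $\mathcal{A}=\{H_1,\dots,H_n\}$ be a central, essential arrangement: the $H_i=\ker f_i$ are distinct hyperplanes through the origin, $f_i$ is a nonzero linear form, and $\mathcal{A}$ contains $\ell$ linearly independent hyperplanes. Put $Q=\prod_{i=1}^n f_i$. Logarithmic derivations: $\mathrm{Der}(\mathcal{A})=\{\theta\in \mathrm{Der}_{\mathbb{C}}(R): \theta(Q)\in (Q)\}$. The arrangement $\mathcal{A}$ is free if $\mathrm{Der}(\mathcal{A})$ is a free $R$-module. Let $C=\mathbb{C}[a_1,\dots,a_n]$ and $S=C\otimes_{\mathbb{C}}R=\mathbb{C}[a_1,\dots,a_n,x_1,\dots,x_\ell]$, and let $\omega_{\mathbf a}=\sum_{i=1}^n a_i\,df_i/f_i$. The logarithmic ideal $I(\mathcal{A})$ is the ideal of $S$ generated by the polynomials $\langle\theta,\omega_{\mathbf a}\rangle=\sum_{i=1}^n a_i\,\theta(f_i)/f_i$ for $\theta\in\mathrm{Der}(\mathcal{A})$. An ideal of $S$ is a complete intersection if it can be generated by a number of elements equal to its codimension (equivalently, its depth). *)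

theory Defs
  imports
    "HOL-Analysis.Analysis"
    "HOL-Algebra.Algebraic_Closure_Type"
    "HOL-Library.Poly_Mapping"
    "HOL-Library.Function_Algebras"
    "HOL-Library.Extended_Nat"
begin

section \<open>Polynomial rings over the complex numbers\<close>

text \<open>
  The ring of complex polynomials in variables indexed by \<open>'v\<close>: finitely supported
  functions from exponent vectors to coefficients, with convolution as multiplication.
\<close>

type_synonym 'v cpoly = "('v \<Rightarrow>\<^sub>0 nat) \<Rightarrow>\<^sub>0 complex"

definition const :: "complex \<Rightarrow> 'v cpoly"
  where "const c = Poly_Mapping.single 0 c"

definition var :: "'v \<Rightarrow> 'v cpoly"
  where "var v = Poly_Mapping.single (Poly_Mapping.single v 1) 1"

text \<open>
  In the ring \<open>S = \<complex>[a\<^sub>1, \<dots>, a\<^sub>n, x\<^sub>1, \<dots>, x\<^sub>\<ell>]\<close> the variables \<open>a\<^sub>i\<close> are indexed by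
  \<open>Inl i\<close> and the variables \<open>x\<^sub>j\<close> by \<open>Inr j\<close>; \<open>incl\<close> is the inclusion of
  \<open>R = \<complex>[x\<^sub>1, \<dots>, x\<^sub>\<ell>]\<close> into \<open>S\<close>.
\<close>

definition incl :: "'l::finite cpoly \<Rightarrow> ('n + 'l) cpoly"
  where "incl p = (\<Sum>m\<in>Poly_Mapping.keys p.
    const (Poly_Mapping.lookup p m) * (\<Prod>j\<in>UNIV. var (Inr j) ^ Poly_Mapping.lookup m j))"

text \<open>
  \<open>exact_quot p q\<close> is \<open>p / q\<close> in case the nonzero polynomial \<open>q\<close> divides \<open>p\<close>
  (the quotient is then unique, as polynomial rings over \<open>\<complex>\<close> are domains),
  and is meaningless otherwise.
\<close>

definition exact_quot :: "'v cpoly \<Rightarrow> 'v cpoly \<Rightarrow> 'v cpoly"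
  where "exact_quot p q = (THE g. p = q * g)"


section \<open>Codimension and complete intersections\<close>

text \<open>
  \<open>ring_of_type_algebra\<close> views a type of class \<open>ring_1\<close> as a ring in the sense of
  \<open>HOL-Algebra\<close>, so that its ideals, generated ideals and prime ideals can be used.
\<close>

abbreviation prime_ideal :: "'a::comm_ring_1 set \<Rightarrow> bool"
  where "prime_ideal P \<equiv> primeideal P (ring_of_type_algebra :: 'a ring)"

abbreviation ideal_generated :: "'a::comm_ring_1 set \<Rightarrow> 'a set"
  where "ideal_generated G \<equiv> genideal (ring_of_type_algebra :: 'a ring) G"

text \<open>The height of a prime: the supremum of the lengths of strict chains of primes ending in it.\<close>

definition height :: "'a::comm_ring_1 set \<Rightarrow> enat"
  where "height P = Sup {enat k | k. \<exists>C :: nat \<Rightarrow> 'a set.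
    (\<forall>i\<le>k. prime_ideal (C i)) \<and> (\<forall>i<k. C i \<subset> C (Suc i)) \<and> C k = P}"

definition codim :: "'a::comm_ring_1 set \<Rightarrow> enat"
  where "codim I = Inf {height P | P. prime_ideal P \<and> I \<subseteq> P}"

definition complete_intersection :: "'a::comm_ring_1 set \<Rightarrow> bool"
  where "complete_intersection I \<longleftrightarrow>
    (\<exists>G. finite G \<and> ideal_generated G = I \<and> enat (card G) = codim I)"


section \<open>Central arrangements\<close>

text \<open>
  A central arrangement in \<open>\<complex>\<^sup>\<ell>\<close>, \<open>\<ell> = CARD('l)\<close>, of \<open>n = CARD('n)\<close> hyperplanes is given by
  the coefficient vectors \<open>f i\<close> of its defining linear forms.
\<close>

definition hyperplane :: "complex ^ 'l \<Rightarrow> (complex ^ 'l) set"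
  where "hyperplane c = {v. (\<Sum>j\<in>UNIV. c $ j * v $ j) = 0}"

definition linear_form :: "complex ^ 'l \<Rightarrow> 'l::finite cpoly"
  where "linear_form c = (\<Sum>j\<in>UNIV. const (c $ j) * var j)"

definition central_arrangement :: "('n::finite \<Rightarrow> complex ^ 'l) \<Rightarrow> bool"
  where "central_arrangement f \<longleftrightarrow> (\<forall>i. f i \<noteq> 0) \<and> inj (\<lambda>i. hyperplane (f i))"

definition essential :: "('n::finite \<Rightarrow> complex ^ 'l) \<Rightarrow> bool"
  where "essential f \<longleftrightarrow>
    (\<exists>J. card J = CARD('l) \<and> inj_on f J \<and> vec.independent (f ` J))"

definition defining_polynomial :: "('n::finite \<Rightarrow> complex ^ 'l) \<Rightarrow> 'l::finite cpoly"
  where "defining_polynomial f = (\<Prod>i\<in>UNIV. linear_form (f i))"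


section \<open>Logarithmic derivations and freeness\<close>

definition derivation :: "('v cpoly \<Rightarrow> 'v cpoly) \<Rightarrow> bool"
  where "derivation \<theta> \<longleftrightarrow>
    (\<forall>p q. \<theta> (p + q) = \<theta> p + \<theta> q) \<and>
    (\<forall>c p. \<theta> (const c * p) = const c * \<theta> p) \<and>
    (\<forall>p q. \<theta> (p * q) = \<theta> p * q + p * \<theta> q)"

definition log_derivations :: "('n::finite \<Rightarrow> complex ^ 'l) \<Rightarrow> ('l::finite cpoly \<Rightarrow> 'l cpoly) set"
  where "log_derivations f =
    {\<theta>. derivation \<theta> \<and> \<theta> (defining_polynomial f) \<in> ideal_generated {defining_polynomial f}}"

text \<open>Self-maps of \<open>R\<close> form an \<open>R\<close>-module under pointwise operations; derivations are a submodule.\<close>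

definition scale_map :: "'v cpoly \<Rightarrow> ('v cpoly \<Rightarrow> 'v cpoly) \<Rightarrow> 'v cpoly \<Rightarrow> 'v cpoly"
  where "scale_map r \<theta> = (\<lambda>p. r * \<theta> p)"

interpretation maps: Modules.module scale_map
  by unfold_locales (simp_all add: scale_map_def fun_eq_iff algebra_simps)

definition free_submodule :: "('v cpoly \<Rightarrow> 'v cpoly) set \<Rightarrow> bool"
  where "free_submodule M \<longleftrightarrow> (\<exists>B. maps.independent B \<and> maps.span B = M)"

definition free_arrangement :: "('n::finite \<Rightarrow> complex ^ 'l::finite) \<Rightarrow> bool"
  where "free_arrangement f \<longleftrightarrow> free_submodule (log_derivations f)"


section \<open>The logarithmic ideal\<close>

text \<open>
  The pairing of a derivation with \<open>\<omega>\<^sub>a = \<Sum>\<^sub>i a\<^sub>i df\<^sub>i/f\<^sub>i\<close>. For logarithmic \<open>\<theta>\<close> every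
  \<open>f\<^sub>i\<close> divides \<open>\<theta>(f\<^sub>i)\<close>, since the \<open>f\<^sub>i\<close> are pairwise non-associated primes;
  so the quotients below are genuine.
\<close>

definition pairing ::
    "('n::finite \<Rightarrow> complex ^ 'l::finite) \<Rightarrow> ('l cpoly \<Rightarrow> 'l cpoly) \<Rightarrow> ('n + 'l) cpoly"
  where "pairing f \<theta> = (\<Sum>i\<in>UNIV.
    var (Inl i) * incl (exact_quot (\<theta> (linear_form (f i))) (linear_form (f i))))"

definition log_ideal :: "('n::finite \<Rightarrow> complex ^ 'l::finite) \<Rightarrow> ('n + 'l) cpoly set"
  where "log_ideal f = ideal_generated (pairing f ` log_derivations f)"

end

theory Submission
  imports Defs
begin

text \<open>
  The theorem rests on two facts about the logarithmic ideal \<open>I\<close>: its part of degree one in the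
  variables \<open>a\<^sub>i\<close> is a copy of the module of logarithmic derivations, and its codimension is
  always exactly \<open>\<ell>\<close>.

  Since \<open>I\<close> is generated in degree one, any generators of \<open>I\<close> may be replaced by their linear
  parts as far as degree one is concerned, so their linear parts generate the module of logarithmic
  derivations (\<open>log_derivations_spanned_by_linear_parts\<close>). That module has rank \<open>\<ell>\<close>: it lies in
  the free module of all derivations and contains \<open>Q\<close> times it. If \<open>I\<close> is a complete
  intersection, the module therefore has \<open>\<ell>\<close> generators, and \<open>\<ell>\<close> generators of a torsion-free
  module of rank \<open>\<ell>\<close> form a basis (\<open>independent_of_spanning_card_le\<close>). Conversely, a basis of the
  module has \<open>\<ell>\<close> elements, and their pairings with \<open>\<omega>\<^sub>a\<close> are \<open>\<ell>\<close> distinct generators of \<open>I\<close>.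

  The codimension is at least \<open>\<ell>\<close> because a prime \<open>P\<close> above \<open>I\<close> contains \<open>\<ell>\<close> independent
  linear relations: the linear forms in \<open>P\<close>, which are relations among the \<open>x\<^sub>j\<close>, and the
  pairings of the vector fields tangent to the common zeros of these forms, which are relations
  among the \<open>a\<^sub>i\<close> (\<open>has_chain_of_log_ideal_subset\<close>). Each of them allows a variable to be
  eliminated, at the cost of one step down in a chain of primes (\<open>chain_of_linear_relations\<close>). It is
  at most \<open>\<ell>\<close> because the solutions of \<open>\<omega>\<^sub>a = 0\<close> over the complement of the arrangement
  can be parametrised by \<open>n\<close> coordinates (\<open>log_ideal_small_prime\<close>), and a chain of primes in
  \<open>n + \<ell>\<close> variables has at most \<open>n + \<ell>\<close> steps. The latter is proved by counting monomials
  (\<open>growth_Suc\<close>, \<open>growth_le\<close>).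
\<close>

section \<open>Ideals of commutative rings\<close>

definition ideal_set :: "'a::comm_ring_1 set \<Rightarrow> bool"
  where "ideal_set I \<longleftrightarrow> 0 \<in> I \<and> (\<forall>a\<in>I. \<forall>b\<in>I. a + b \<in> I) \<and> (\<forall>a\<in>I. \<forall>r. r * a \<in> I)"

lemma ideal_iff: "ideal I (ring_of_type_algebra :: 'a::comm_ring_1 ring) \<longleftrightarrow> ideal_set I"
proof
  assume "ideal I (ring_of_type_algebra :: 'a ring)"
  then interpret ideal I "ring_of_type_algebra :: 'a ring" .
  show "ideal_set I"
    using additive_subgroup.zero_closed[OF is_additive_subgroup]
      additive_subgroup.a_closed[OF is_additive_subgroup] I_l_closed
    by (simp add: ideal_set_def ring_of_type_algebra_def)
next
  assume I: "ideal_set I"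
  have ring: "ring (ring_of_type_algebra :: 'a ring)" by (rule ring_from_type_algebra)
  then interpret ring "ring_of_type_algebra :: 'a ring" .
  have minus: "- a \<in> I" if "a \<in> I" for a
    using I that by (metis ideal_set_def mult_minus1)
  have inv: "\<ominus>\<^bsub>ring_of_type_algebra\<^esub> a = - a" for a :: 'a
    by (rule minus_equality) (simp_all add: ring_of_type_algebra_def)
  show "ideal I (ring_of_type_algebra :: 'a ring)"
  proof (rule idealI[OF ring])
    show "subgroup I (add_monoid (ring_of_type_algebra :: 'a ring))"
    proof (rule add.subgroupI)
      show "\<ominus>\<^bsub>ring_of_type_algebra\<^esub> a \<in> I" if "a \<in> I" for a
        using minus[OF that] by (simp add: inv)
    qed (use I in \<open>auto simp: ideal_set_def ring_of_type_algebra_def\<close>)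
  qed (use I in \<open>auto simp: ideal_set_def ring_of_type_algebra_def mult.commute\<close>)
qed

lemma prime_ideal_iff:
  "prime_ideal P \<longleftrightarrow>
    ideal_set P \<and> 1 \<notin> P \<and> (\<forall>a b. a * b \<in> P \<longrightarrow> a \<in> P \<or> b \<in> P)"
proof
  assume "prime_ideal P"
  then interpret primeideal P ring_of_type_algebra .
  have "ideal_set P" using ideal_axioms by (simp add: ideal_iff)
  moreover have "1 \<notin> P"
    using I_notcarr one_imp_carrier by (auto simp: ring_of_type_algebra_def)
  ultimately show "ideal_set P \<and> 1 \<notin> P \<and> (\<forall>a b. a * b \<in> P \<longrightarrow> a \<in> P \<or> b \<in> P)"
    using I_prime by (simp add: ring_of_type_algebra_def)
next
  assume P: "ideal_set P \<and> 1 \<notin> P \<and> (\<forall>a b. a * b \<in> P \<longrightarrow> a \<in> P \<or> b \<in> P)"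
  show "prime_ideal P"
    using P ideal_iff[of P]
    by (intro primeidealI cring_from_type_algebra) (auto simp: ring_of_type_algebra_def)
qed

lemma ideal_generated_eq: "ideal_generated G = \<Inter>{I. ideal_set I \<and> G \<subseteq> I}"
  by (simp add: genideal_def ideal_iff)

lemma
  assumes "ideal_set I"
  shows ideal_set_zero: "0 \<in> I"
    and ideal_set_add: "a \<in> I \<Longrightarrow> b \<in> I \<Longrightarrow> a + b \<in> I"
    and ideal_set_mult: "a \<in> I \<Longrightarrow> r * a \<in> I"
    and ideal_set_mult': "a \<in> I \<Longrightarrow> a * r \<in> I"
  using assms by (simp_all add: ideal_set_def mult.commute)

lemma ideal_set_minus: "ideal_set I \<Longrightarrow> a \<in> I \<Longrightarrow> - a \<in> I"
  using ideal_set_mult[of I a "-1"] by simp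

lemma ideal_set_diff: "ideal_set I \<Longrightarrow> a \<in> I \<Longrightarrow> b \<in> I \<Longrightarrow> a - b \<in> I"
  using ideal_set_add[of I a "- b"] ideal_set_minus[of I b] by simp

lemma ideal_set_sum: "ideal_set I \<Longrightarrow> (\<And>x. x \<in> A \<Longrightarrow> g x \<in> I) \<Longrightarrow> sum g A \<in> I"
  by (induction A rule: infinite_finite_induct) (auto simp: ideal_set_zero ideal_set_add)

lemma
  assumes "prime_ideal P"
  shows prime_ideal_ideal: "ideal_set P"
    and prime_ideal_one: "1 \<notin> P"
    and prime_ideal_mult: "a * b \<in> P \<longleftrightarrow> a \<in> P \<or> b \<in> P"
  using assms unfolding prime_ideal_iff by (blast intro: ideal_set_mult ideal_set_mult')+

lemma prime_ideal_power: "prime_ideal P \<Longrightarrow> a ^ k \<in> P \<Longrightarrow> a \<in> P"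
  by (induction k) (auto simp: prime_ideal_mult prime_ideal_one)

lemma prime_ideal_prod:
  "prime_ideal P \<Longrightarrow> prod g A \<in> P \<Longrightarrow> \<exists>x\<in>A. g x \<in> P"
  by (induction A rule: infinite_finite_induct) (auto simp: prime_ideal_mult prime_ideal_one)

lemma ideal_generated_ideal: "ideal_set (ideal_generated G)"
  by (auto simp: ideal_generated_eq ideal_set_def)

lemma ideal_generated_incl: "g \<in> G \<Longrightarrow> g \<in> ideal_generated G"
  by (auto simp: ideal_generated_eq)

lemma ideal_generated_minimal: "ideal_set I \<Longrightarrow> G \<subseteq> I \<Longrightarrow> ideal_generated G \<subseteq> I"
  by (auto simp: ideal_generated_eq)

lemma mem_ideal_generatedE:
  assumes "x \<in> ideal_generated G"
  obtains T r where "finite T" "T \<subseteq> G" "x = (\<Sum>g\<in>T. r g * g)"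
proof -
  let ?I = "{x. \<exists>T r. finite T \<and> T \<subseteq> G \<and> x = (\<Sum>g\<in>T. r g * g)}"
  have "ideal_set ?I"
    unfolding ideal_set_def
  proof (intro conjI ballI allI)
    show "0 \<in> ?I" by (intro CollectI exI[of _ "{}"]) auto
  next
    fix a b assume "a \<in> ?I" "b \<in> ?I"
    then obtain T r T' r' where T: "finite T" "T \<subseteq> G" "a = (\<Sum>g\<in>T. r g * g)"
      and T': "finite T'" "T' \<subseteq> G" "b = (\<Sum>g\<in>T'. r' g * g)" by blast
    have "a = (\<Sum>g\<in>T \<union> T'. (if g \<in> T then r g else 0) * g)"
      unfolding T by (intro sum.mono_neutral_cong_left) (use T T' in auto)
    moreover have "b = (\<Sum>g\<in>T \<union> T'. (if g \<in> T' then r' g else 0) * g)"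
      unfolding T' by (intro sum.mono_neutral_cong_left) (use T T' in auto)
    ultimately have "a + b = (\<Sum>g\<in>T \<union> T'.
        ((if g \<in> T then r g else 0) + (if g \<in> T' then r' g else 0)) * g)"
      by (simp add: sum.distrib distrib_right)
    then show "a + b \<in> ?I"
      using T T' by (intro CollectI exI[of _ "T \<union> T'"] conjI exI) auto
  next
    fix a s assume "a \<in> ?I"
    then obtain T r where T: "finite T" "T \<subseteq> G" "a = (\<Sum>g\<in>T. r g * g)" by blast
    then have "s * a = (\<Sum>g\<in>T. (s * r g) * g)" by (simp add: sum_distrib_left mult.assoc)
    with T show "s * a \<in> ?I" by (intro CollectI exI[of _ T] conjI exI) auto
  qed
  moreover have "G \<subseteq> ?I"
  proof
    fix g assume "g \<in> G"
    then show "g \<in> ?I" by (intro CollectI exI[of _ "{g}"] exI[of _ "\<lambda>_. 1"]) auto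
  qed
  ultimately have "x \<in> ?I" using assms ideal_generated_minimal by blast
  then show thesis using that by blast
qed

lemma ideal_generated_finite:
  assumes "finite G" "x \<in> ideal_generated G"
  obtains r where "x = (\<Sum>g\<in>G. r g * g)"
proof -
  obtain T r where T: "finite T" "T \<subseteq> G" "x = (\<Sum>g\<in>T. r g * g)"
    using mem_ideal_generatedE[OF assms(2)] .
  have "x = (\<Sum>g\<in>G. (if g \<in> T then r g else 0) * g)"
    unfolding T by (intro sum.mono_neutral_cong_left) (use T assms in auto)
  then show thesis by (rule that)
qed

lemma mem_ideal_generated_singleton: "x \<in> ideal_generated {q} \<longleftrightarrow> q dvd x"
proof
  assume "x \<in> ideal_generated {q}"
  then obtain r where "x = (\<Sum>g\<in>{q}. r g * g)" by (rule ideal_generated_finite[rotated]) auto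
  then show "q dvd x" by simp
next
  assume "q dvd x"
  then show "x \<in> ideal_generated {q}"
    using ideal_set_mult'[OF ideal_generated_ideal ideal_generated_incl] by blast
qed

section \<open>Polynomials\<close>

lemma single_plus_induct [case_names single add]:
  assumes "\<And>m c. Q (Poly_Mapping.single m c)" and "\<And>p q. Q p \<Longrightarrow> Q q \<Longrightarrow> Q (p + q)"
  shows "Q (p :: 'a \<Rightarrow>\<^sub>0 'b::comm_monoid_add)"
proof -
  have p: "p = (\<Sum>m\<in>Poly_Mapping.keys p. Poly_Mapping.single m (Poly_Mapping.lookup p m))"
    by (rule poly_mapping_eqI)
      (auto simp: lookup_sum lookup_single when_def in_keys_iff sum.delta)
  have "Q (\<Sum>m\<in>A. Poly_Mapping.single m (Poly_Mapping.lookup p m))" if "finite A" for A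
    using that
  proof induction
    case empty
    show ?case using assms(1)[of undefined 0] by simp
  qed (simp add: assms)
  then show ?thesis by (subst p) simp
qed

lemma const_0 [simp]: "const 0 = 0" and const_1 [simp]: "const 1 = 1"
  and const_add: "const (a + b) = const a + const b"
  and const_mult: "const (a * b) = const a * const b"
  by (simp_all add: const_def single_add mult_single)

lemma const_sum: "const (sum g A) = (\<Sum>x\<in>A. const (g x))"
  by (induction A rule: infinite_finite_induct) (auto simp: const_add)

lemma var_power: "var v ^ k = Poly_Mapping.single (Poly_Mapping.single v k) 1"
  by (induction k) (auto simp: var_def mult_single simp flip: single_add)

lemma single_eq_prod_var:
  "Poly_Mapping.single m c
    = const c * (\<Prod>v\<in>UNIV. var (v :: 'v::finite) ^ Poly_Mapping.lookup m v)"
proof -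
  have "(\<Prod>v\<in>A. var v ^ Poly_Mapping.lookup m v)
      = Poly_Mapping.single (\<Sum>v\<in>A. Poly_Mapping.single v (Poly_Mapping.lookup m v)) 1" for A
    by (induction A rule: infinite_finite_induct) (auto simp: var_power mult_single)
  moreover have "(\<Sum>v\<in>UNIV. Poly_Mapping.single v (Poly_Mapping.lookup m v)) = m"
    by (rule poly_mapping_eqI) (simp add: lookup_sum lookup_single when_def)
  ultimately show ?thesis by (simp add: const_def mult_single)
qed

lemma cpoly_induct [case_names const var add mult]:
  fixes p :: "'v::finite cpoly"
  assumes c: "\<And>c. Q (const c)" and v: "\<And>v. Q (var v)"
    and a: "\<And>p q. Q p \<Longrightarrow> Q q \<Longrightarrow> Q (p + q)" and m: "\<And>p q. Q p \<Longrightarrow> Q q \<Longrightarrow> Q (p * q)"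
  shows "Q p"
proof (induction p rule: single_plus_induct)
  case (single e c)
  have pow: "Q (var v ^ k)" for v k
    by (induction k) (use c[of 1] v m in auto)
  have "Q (\<Prod>v\<in>A. var v ^ Poly_Mapping.lookup e v)" for A
    by (induction A rule: infinite_finite_induct) (use c[of 1] pow m in auto)
  then show ?case unfolding single_eq_prod_var by (intro m c)
qed (rule a)

text \<open>
  The polynomial ring is used through its universal property: homomorphisms into any
  commutative ring are built by \<open>insertion\<close> and compared on constants and variables
  only. Values in a ring of univariate polynomials make derivations, Taylor coefficients and
  coefficients with respect to a single variable instances of the same construction.
\<close>

definition comm_ring_hom :: "('a::comm_ring_1 \<Rightarrow> 'b::comm_ring_1) \<Rightarrow> bool"
  where "comm_ring_hom h \<longleftrightarrow> h 1 = 1 \<and> (\<forall>a b. h (a + b) = h a + h b) \<and> (\<forall>a b. h (a * b) = h a * h b)"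

context
  fixes h :: "'a::comm_ring_1 \<Rightarrow> 'b::comm_ring_1"
  assumes h: "comm_ring_hom h"
begin

lemma comm_ring_hom_1: "h 1 = 1" and comm_ring_hom_add: "h (a + b) = h a + h b"
  and comm_ring_hom_mult: "h (a * b) = h a * h b"
  using h by (simp_all add: comm_ring_hom_def)

lemma comm_ring_hom_0: "h 0 = 0"
  using comm_ring_hom_add[of 0 0] by simp

lemma comm_ring_hom_minus: "h (- a) = - h a"
  using comm_ring_hom_add[of a "- a"] by (simp add: comm_ring_hom_0 eq_neg_iff_add_eq_0 add.commute)

lemma comm_ring_hom_diff: "h (a - b) = h a - h b"
  using comm_ring_hom_add[of a "- b"] by (simp add: comm_ring_hom_minus)

lemma comm_ring_hom_sum: "h (sum g A) = (\<Sum>x\<in>A. h (g x))"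
  by (induction A rule: infinite_finite_induct) (auto simp: comm_ring_hom_0 comm_ring_hom_add)

lemma comm_ring_hom_prod: "h (prod g A) = (\<Prod>x\<in>A. h (g x))"
  by (induction A rule: infinite_finite_induct) (auto simp: comm_ring_hom_1 comm_ring_hom_mult)

lemmas comm_ring_hom_simps = comm_ring_hom_0 comm_ring_hom_1 comm_ring_hom_add comm_ring_hom_mult
  comm_ring_hom_minus comm_ring_hom_diff comm_ring_hom_sum comm_ring_hom_prod

lemma prime_ideal_vimage: "prime_ideal P \<Longrightarrow> prime_ideal (h -` P)"
  unfolding prime_ideal_iff ideal_set_def by (auto simp: comm_ring_hom_simps)

end

lemma comm_ring_hom_const: "comm_ring_hom const"
  by (simp add: comm_ring_hom_def const_add const_mult)

lemma comm_ring_hom_pCons: "comm_ring_hom h \<Longrightarrow> comm_ring_hom (\<lambda>c. [:h c:])"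
  by (simp add: comm_ring_hom_def one_pCons)

definition insertion ::
    "(complex \<Rightarrow> 'r::comm_ring_1) \<Rightarrow> ('v::finite \<Rightarrow> 'r) \<Rightarrow> 'v cpoly \<Rightarrow> 'r"
  where "insertion h s p = (\<Sum>m\<in>Poly_Mapping.keys p.
    h (Poly_Mapping.lookup p m) * (\<Prod>v\<in>UNIV. s v ^ Poly_Mapping.lookup m v))"

context
  fixes h :: "complex \<Rightarrow> 'r::comm_ring_1" and s :: "'v::finite \<Rightarrow> 'r"
  assumes h: "comm_ring_hom h"
begin

lemma insertion_add: "insertion h s (p + q) = insertion h s p + insertion h s q"
  unfolding insertion_def
  by (rule setsum_keys_plus_distrib) (simp_all add: comm_ring_hom_simps[OF h] distrib_right)

lemma insertion_single:
  "insertion h s (Poly_Mapping.single m c) = h c * (\<Prod>v\<in>UNIV. s v ^ Poly_Mapping.lookup m v)"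
  by (simp add: insertion_def comm_ring_hom_0[OF h])

lemma insertion_mult: "insertion h s (p * q) = insertion h s p * insertion h s q"
proof (induction p rule: single_plus_induct)
  case (single m c)
  show ?case
  proof (induction q rule: single_plus_induct)
    case (single m' c')
    show ?case
      by (simp add: mult_single insertion_single comm_ring_hom_mult[OF h] lookup_add power_add
          prod.distrib mult_ac)
  qed (simp add: distrib_left insertion_add)
qed (simp add: distrib_right insertion_add)

lemma insertion_const [simp]: "insertion h s (const c) = h c"
  by (simp add: const_def insertion_single)

lemma insertion_var [simp]: "insertion h s (var v) = s v"
proof -
  have "(\<Prod>w\<in>UNIV. s w ^ Poly_Mapping.lookup (Poly_Mapping.single v 1) w)
      = (\<Prod>w\<in>UNIV. if w = v then s w else 1)"
    by (rule prod.cong) (auto simp: lookup_single when_def)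
  then show ?thesis by (simp add: var_def insertion_single comm_ring_hom_1[OF h])
qed

lemma comm_ring_hom_insertion: "comm_ring_hom (insertion h s)"
  using insertion_const[of 1] by
      (simp add: comm_ring_hom_def insertion_add insertion_mult comm_ring_hom_1[OF h])

end

lemma comm_ring_hom_eqI:
  fixes F :: "'v::finite cpoly \<Rightarrow> 'r::comm_ring_1"
  assumes "comm_ring_hom F" "comm_ring_hom G" "\<And>c. F (const c) = G (const c)"
      "\<And>v. F (var v) = G (var v)"
  shows "F p = G p"
  by (induction p rule: cpoly_induct) (use assms in \<open>auto simp: comm_ring_hom_simps\<close>)

lemma comm_ring_hom_comp: "comm_ring_hom F \<Longrightarrow> comm_ring_hom G \<Longrightarrow> comm_ring_hom (\<lambda>x. F (G x))"
  by (simp add: comm_ring_hom_def)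

lemma comm_ring_hom_id: "comm_ring_hom (\<lambda>x. x)"
  by (simp add: comm_ring_hom_def)

text \<open>
  Linearly ordered monomials have leading terms, so that polynomials in them form a domain; an
  enumeration of the finitely many variables embeds the given ring into such a ring.
\<close>

lemma cpoly_no_zero_divisors:
  fixes p q :: "'v::finite cpoly"
  assumes "p * q = 0"
  shows "p = 0 \<or> q = 0"
proof -
  define enc :: "('v \<Rightarrow>\<^sub>0 nat) \<Rightarrow> (nat \<Rightarrow>\<^sub>0 nat)"
    where "enc m = (\<Sum>v\<in>UNIV. Poly_Mapping.single (to_nat v) (Poly_Mapping.lookup m v))" for m
  have "Poly_Mapping.lookup (enc m) (to_nat v) = Poly_Mapping.lookup m v" for m v
    by (simp add: enc_def lookup_sum lookup_single when_def)
  then have inj: "enc m = enc m' \<longleftrightarrow> m = m'" for m m'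
    by (metis poly_mapping_eqI)
  let ?F = "insertion const (\<lambda>v :: 'v. var (to_nat v))"
  have hom: "comm_ring_hom ?F" by (rule comm_ring_hom_insertion[OF comm_ring_hom_const])
  have prod: "(\<Prod>v\<in>A. var (to_nat v) ^ Poly_Mapping.lookup m v) = Poly_Mapping.single
      (\<Sum>v\<in>A. Poly_Mapping.single (to_nat v) (Poly_Mapping.lookup m v)) (1 :: complex)"
    for m and A :: "'v set"
    by (induction A rule: infinite_finite_induct) (auto simp: var_power mult_single)
  have F: "?F r = (\<Sum>m\<in>Poly_Mapping.keys r. Poly_Mapping.single (enc m) (Poly_Mapping.lookup r m))"
    for r
    by (simp add: insertion_def prod const_def mult_single enc_def)
  have lookup: "Poly_Mapping.lookup (?F r) (enc m) = Poly_Mapping.lookup r m" for r m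
    by (auto simp: F lookup_sum lookup_single when_def inj in_keys_iff)
  have zero: "r = 0" if "?F r = 0" for r
    using lookup[of r] that by (intro poly_mapping_eqI) simp
  have "?F p * ?F q = 0"
    using assms comm_ring_hom_mult[OF hom, of p q] comm_ring_hom_0[OF hom] by simp
  then show ?thesis using zero by auto
qed

lemma prime_ideal_zero: "prime_ideal {0 :: 'v::finite cpoly}"
  using cpoly_no_zero_divisors by (auto simp: prime_ideal_iff ideal_set_def)

lemma cpoly_mult_eq_0_iff: "p * q = 0 \<longleftrightarrow> p = 0 \<or> q = (0 :: 'v::finite cpoly)"
  using cpoly_no_zero_divisors by auto

lemma exact_quot_mult: "q \<noteq> 0 \<Longrightarrow> exact_quot (q * g) q = (g :: 'v::finite cpoly)"
  unfolding exact_quot_def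
proof (rule the_equality)
  fix g' assume "q \<noteq> 0" "q * g = q * g'"
  then have "q * (g' - g) = 0" by (simp add: algebra_simps)
  with \<open>q \<noteq> 0\<close> show "g' = g" by (simp add: cpoly_mult_eq_0_iff)
qed simp

lemma exact_quot_cancel: "q \<noteq> 0 \<Longrightarrow> q dvd p \<Longrightarrow> q * exact_quot p q = (p :: 'v::finite cpoly)"
  by (auto simp: exact_quot_mult)

abbreviation subst :: "('v::finite \<Rightarrow> 'w cpoly) \<Rightarrow> 'v cpoly \<Rightarrow> 'w cpoly"
  where "subst \<equiv> insertion const"

lemmas comm_ring_hom_subst = comm_ring_hom_insertion[OF comm_ring_hom_const]
lemmas subst_simps = comm_ring_hom_simps[OF comm_ring_hom_subst]
    insertion_const[OF comm_ring_hom_const]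
  insertion_var[OF comm_ring_hom_const]

lemma incl_eq_subst: "incl p = subst (\<lambda>j. var (Inr j)) p"
  by (simp add: incl_def insertion_def)

lemma comm_ring_hom_incl: "comm_ring_hom incl"
  unfolding incl_eq_subst by (rule comm_ring_hom_subst)

lemma incl_const [simp]: "incl (const c) = const c"
    and incl_var [simp]: "incl (var j) = var (Inr j)"
  by (simp_all add: incl_eq_subst subst_simps)

lemmas incl_simps = comm_ring_hom_simps[OF comm_ring_hom_incl]

section \<open>Linear dependence modulo a prime\<close>

text \<open>
  Over the field of fractions of the quotient by \<open>P\<close> this is the familiar fact that more
  vectors than coordinates are dependent. Cross-multiplication with a pivot outside \<open>P\<close>
  replaces division.
\<close>

lemma linear_dependence_mod_prime:
  fixes P :: "'a::comm_ring_1 set" and g :: "'j \<Rightarrow> 'e \<Rightarrow> 'a"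
  assumes P: "prime_ideal P" and E: "finite E" and "finite J" "card E < card J"
  shows "\<exists>r. (\<exists>j\<in>J. r j \<notin> P) \<and> (\<forall>e\<in>E. (\<Sum>j\<in>J. r j * g j e) \<in> P)"
  using E assms(3,4)
proof (induction E arbitrary: J g rule: finite_induct)
  case empty
  then show ?case using prime_ideal_one[OF P]
    by (intro exI[of _ "\<lambda>_. 1"]) (auto simp: card_gt_0_iff)
next
  case (insert e E)
  note id = prime_ideal_ideal[OF P]
  show ?case
  proof (cases "\<forall>j\<in>J. g j e \<in> P")
    case True
    have "card E < card J" using insert by simp
    from insert.IH[OF insert.prems(1) this, of g] obtain r where
      r: "\<exists>j\<in>J. r j \<notin> P" "\<forall>e\<in>E. (\<Sum>j\<in>J. r j * g j e) \<in> P" by blast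
    have "(\<Sum>j\<in>J. r j * g j e) \<in> P"
      by (intro ideal_set_sum[OF id] ideal_set_mult[OF id]) (use True in auto)
    with r show ?thesis by auto
  next
    case False
    then obtain k where k: "k \<in> J" "g k e \<notin> P" by blast
    \<comment> \<open>eliminate the coordinate \<open>e\<close> with the pivot row \<open>k\<close>\<close>
    define g' where "g' j d = g k e * g j d - g j e * g k d" for j d
    have "card E < card (J - {k})" using insert k by auto
    from insert.IH[OF _ this, of g'] insert.prems obtain r where
      r: "\<exists>j\<in>J - {k}. r j \<notin> P" "\<forall>e\<in>E. (\<Sum>j\<in>J - {k}. r j * g' j e) \<in> P" by auto
    define s where "s j = (if j = k then - (\<Sum>i\<in>J - {k}. r i * g i e) else r j * g k e)" for j
    have s: "(\<Sum>j\<in>J. s j * g j d) = (\<Sum>j\<in>J - {k}. r j * g' j d)" for d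
    proof -
      have "(\<Sum>j\<in>J. s j * g j d) = s k * g k d + (\<Sum>j\<in>J - {k}. s j * g j d)"
        using insert k by (simp add: sum.remove)
      also have "(\<Sum>j\<in>J - {k}. s j * g j d) = (\<Sum>j\<in>J - {k}. r j * (g k e * g j d))"
        by (rule sum.cong) (auto simp: s_def mult.assoc)
      also have "s k * g k d = - (\<Sum>i\<in>J - {k}. r i * (g i e * g k d))"
        by (simp add: s_def sum_distrib_right mult.assoc)
      finally show ?thesis by (simp add: g'_def right_diff_distrib sum_subtractf)
    qed
    have "\<exists>j\<in>J. s j \<notin> P"
      using r(1) k by (auto simp: s_def prime_ideal_mult[OF P])
    moreover have "(\<Sum>j\<in>J - {k}. r j * g' j e) = 0"
      by (simp add: g'_def mult.commute)
    ultimately show ?thesis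
      using r(2) by (intro exI[of _ s]) (auto simp: s ideal_set_zero[OF id])
  qed
qed

section \<open>Bounding chains of primes from above by counting monomials\<close>

definition has_chain :: "nat \<Rightarrow> 'a::comm_ring_1 set \<Rightarrow> bool"
  where "has_chain k P \<longleftrightarrow> (\<exists>C :: nat \<Rightarrow> 'a set.
    (\<forall>i\<le>k. prime_ideal (C i)) \<and> (\<forall>i<k. C i \<subset> C (Suc i)) \<and> C k = P)"

lemma has_chain_0: "prime_ideal P \<Longrightarrow> has_chain 0 P"
  unfolding has_chain_def by (intro exI[of _ "\<lambda>_. P"]) auto

lemma has_chain_Suc:
  assumes "has_chain k P" "P \<subset> P'" "prime_ideal P'"
  shows "has_chain (Suc k) P'"
proof -
  obtain C where C: "\<forall>i\<le>k. prime_ideal (C i)" "\<forall>i<k. C i \<subset> C (Suc i)" "C k = P"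
    using assms(1) unfolding has_chain_def by blast
  show ?thesis
    unfolding has_chain_def
    by (intro exI[of _ "C(Suc k := P')"]) (use C assms in \<open>auto simp: le_Suc_eq less_Suc_eq\<close>)
qed

lemma height_eq: "height P = Sup {enat k | k. has_chain k P}"
  by (simp add: height_def has_chain_def)

lemma has_chain_le_height: "has_chain k P \<Longrightarrow> enat k \<le> height P"
  unfolding height_eq by (rule Sup_upper) blast

lemma height_le: "(\<And>k. has_chain k P \<Longrightarrow> k \<le> n) \<Longrightarrow> height P \<le> enat n"
  unfolding height_eq by (rule Sup_least) auto

definition exponents_bounded :: "nat \<Rightarrow> 'v cpoly \<Rightarrow> bool"
  where "exponents_bounded D p \<longleftrightarrow>
    (\<forall>m\<in>Poly_Mapping.keys p. \<forall>v. Poly_Mapping.lookup m v \<le> D)"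

lemma exponents_bounded_mono: "exponents_bounded D p \<Longrightarrow> D \<le> D' \<Longrightarrow> exponents_bounded D' p"
  unfolding exponents_bounded_def using order_trans by blast

lemma exponents_bounded_1: "exponents_bounded D 1"
  by (simp add: exponents_bounded_def)

lemma exponents_bounded_mult:
  assumes "exponents_bounded D p" "exponents_bounded D' q"
  shows "exponents_bounded (D + D') (p * q)"
  unfolding exponents_bounded_def
proof (intro ballI allI)
  fix m v assume "m \<in> Poly_Mapping.keys (p * q)"
  then obtain a b where "m = a + b" "a \<in> Poly_Mapping.keys p" "b \<in> Poly_Mapping.keys q"
    using keys_mult[of p q] by blast
  then show "Poly_Mapping.lookup m v \<le> D + D'"
    using assms by (auto simp: exponents_bounded_def lookup_add intro: add_mono)
qed

lemma exponents_bounded_power: "exponents_bounded D p \<Longrightarrow> exponents_bounded (k * D) (p ^ k)"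
  by (induction k) (auto simp: exponents_bounded_1 exponents_bounded_mult)

lemma exponents_bounded_ex: "\<exists>D. exponents_bounded D (p :: 'v::finite cpoly)"
proof -
  let ?S = "(\<lambda>(m, v). Poly_Mapping.lookup m v) ` (Poly_Mapping.keys p \<times> UNIV)"
  have "finite ?S" by simp
  then obtain B where "\<forall>x\<in>?S. x \<le> B" unfolding finite_nat_set_iff_bounded_le by blast
  then have "exponents_bounded B p" by (force simp: exponents_bounded_def)
  then show ?thesis ..
qed

definition independent_mod :: "'v cpoly set \<Rightarrow> 'i set \<Rightarrow> ('i \<Rightarrow> 'v cpoly) \<Rightarrow> bool"
  where "independent_mod P I w \<longleftrightarrow>
    (\<forall>c. (\<Sum>i\<in>I. const (c i) * w i) \<in> P \<longrightarrow> (\<forall>i\<in>I. c i = 0))"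

text \<open>
  A substitute for "the quotient by \<open>P\<close> has transcendence degree at least \<open>d\<close>": it
  contains \<open>m ^ d\<close> linearly independent residues of polynomials whose degrees grow only linearly
  in \<open>m\<close>. The index sets consist of lists merely because a product with one more range of
  numbers is then again an index set of the same type.
\<close>

definition growth :: "nat \<Rightarrow> 'v cpoly set \<Rightarrow> bool"
  where "growth d P \<longleftrightarrow> (\<exists>D. \<forall>m. \<exists>(I :: nat list set) w. finite I \<and> card I = m ^ d \<and>
    (\<forall>i\<in>I. exponents_bounded (D * m) (w i)) \<and> independent_mod P I w)"

lemma prime_ideal_complex_zero: "prime_ideal {0 :: complex}"
  by (auto simp: prime_ideal_iff ideal_set_def)

lemma growth_0:
  assumes P: "prime_ideal (P :: 'v cpoly set)"
  shows "growth 0 P"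
proof -
  have "independent_mod P {[] :: nat list} (\<lambda>_. 1)"
    unfolding independent_mod_def
  proof (intro allI impI ballI)
    fix c and i :: "nat list" assume "(\<Sum>i\<in>{[] :: nat list}. const (c i) * 1) \<in> P" "i \<in> {[]}"
    then have c: "const (c i) \<in> P" by simp
    show "c i = 0"
    proof (rule ccontr)
      assume "c i \<noteq> 0"
      then have "const (inverse (c i)) * const (c i) = (1 :: 'v cpoly)" by (simp flip: const_mult)
      then show False
        using ideal_set_mult[OF prime_ideal_ideal[OF P] c, of "const (inverse (c i))"]
          prime_ideal_one[OF P] by simp
    qed
  qed
  then show ?thesis
    unfolding growth_def
    by (intro exI[of _ 0] allI exI[of _ "{[]}"] exI[of _ "\<lambda>_. 1"]) (simp add: exponents_bounded_1)
qed

text \<open>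
  Passing to a strictly smaller prime raises the growth: an element \<open>g\<close> of \<open>P' - P\<close> behaves
  modulo \<open>P\<close> like a new variable, because in a relation among the products \<open>g ^ k * w i\<close> the
  lowest power of \<open>g\<close> can be cancelled, and what remains modulo \<open>P'\<close> is a relation among
  the \<open>w i\<close>.
\<close>

lemma growth_Suc:
  assumes P: "prime_ideal P" and P': "prime_ideal P'" and "P \<subset> P'" and "growth d P'"
  shows "growth (Suc d) (P :: 'v::finite cpoly set)"
proof -
  obtain g where g: "g \<in> P'" "g \<notin> P" using \<open>P \<subset> P'\<close> by blast
  obtain D' where D': "exponents_bounded D' g" using exponents_bounded_ex by blast
  obtain D where D: "\<exists>(I :: nat list set) w. finite I \<and> card I = m ^ d \<and>
      (\<forall>i\<in>I. exponents_bounded (D * m) (w i)) \<and> independent_mod P' I w" for m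
    using \<open>growth d P'\<close> unfolding growth_def by blast
  note id = prime_ideal_ideal[OF P] and id' = prime_ideal_ideal[OF P']
  have "\<exists>(I :: nat list set) w. finite I \<and> card I = m ^ Suc d \<and>
      (\<forall>i\<in>I. exponents_bounded ((D + D') * m) (w i)) \<and> independent_mod P I w" for m
  proof -
    obtain I :: "nat list set" and w where I: "finite I" "card I = m ^ d"
      and w: "\<And>i. i \<in> I \<Longrightarrow> exponents_bounded (D * m) (w i)" and indep: "independent_mod P' I w"
      using D[of m] by blast
    define I' where "I' = (\<lambda>(k, i). k # i) ` ({..<m} \<times> I)"
    define w' where "w' i = g ^ hd i * w (tl i)" for i
    have inj: "inj_on (\<lambda>(k, i). k # i) ({..<m} \<times> I)" by (auto simp: inj_on_def)
    have "card I' = m ^ Suc d" using I by (simp add: I'_def card_image[OF inj])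
    moreover have "exponents_bounded ((D + D') * m) (w' i)" if "i \<in> I'" for i
    proof -
      from that obtain k j where kj: "i = k # j" "k < m" "j \<in> I" by (auto simp: I'_def)
      have "exponents_bounded (k * D' + D * m) (w' i)"
        unfolding w'_def kj list.sel
        by (intro exponents_bounded_mult exponents_bounded_power D' w kj)
      moreover have "k * D' + D * m \<le> (D + D') * m"
        using kj by (simp add: algebra_simps)
      ultimately show ?thesis by (rule exponents_bounded_mono)
    qed
    moreover have "independent_mod P I' w'"
      unfolding independent_mod_def
    proof (intro allI impI ballI)
      fix c i assume c: "(\<Sum>i\<in>I'. const (c i) * w' i) \<in> P" and i: "i \<in> I'"
      define q where "q k = (\<Sum>i\<in>I. const (c (k # i)) * w i)" for k
      have sum: "(\<Sum>i\<in>I'. const (c i) * w' i) = (\<Sum>k<m. g ^ k * q k)"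
      proof -
        have "(\<Sum>i\<in>I'. const (c i) * w' i)
            = (\<Sum>(k, i)\<in>{..<m} \<times> I. g ^ k * (const (c (k # i)) * w i))"
          unfolding I'_def
          by (subst sum.reindex[OF inj]) (auto intro!: sum.cong simp: w'_def mult_ac)
        also have "\<dots> = (\<Sum>k<m. \<Sum>i\<in>I. g ^ k * (const (c (k # i)) * w i))"
          by (rule sum.cartesian_product[symmetric])
        finally show ?thesis by (simp add: q_def sum_distrib_left)
      qed
      have zero: "\<forall>i\<in>I. c (k # i) = 0" if "k < m" for k
        using that
      proof (induction k rule: less_induct)
        case (less k)
        \<comment> \<open>the blocks below \<open>k\<close> vanish, so \<open>g ^ k\<close> can be cancelled modulo \<open>P\<close>\<close>
        have "(\<Sum>j<m. g ^ j * q j) = (\<Sum>j\<in>{k..<m}. g ^ j * q j)"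
        proof (rule sum.mono_neutral_right)
          show "\<forall>j\<in>{..<m} - {k..<m}. g ^ j * q j = 0"
            using less.IH by (auto simp: q_def)
        qed auto
        also have "\<dots> = g ^ k * q k + (\<Sum>j\<in>{Suc k..<m}. g ^ j * q j)"
          using less.prems by (simp add: sum.atLeast_Suc_lessThan)
        also have "(\<Sum>j\<in>{Suc k..<m}. g ^ j * q j)
            = (\<Sum>j\<in>{Suc k..<m}. g ^ k * (g * (g ^ (j - Suc k) * q j)))"
        proof (rule sum.cong)
          fix j assume "j \<in> {Suc k..<m}"
          then have "g ^ j = g ^ k * (g * g ^ (j - Suc k))"
            by (simp flip: power_Suc power_add)
          then show "g ^ j * q j = g ^ k * (g * (g ^ (j - Suc k) * q j))"
            by (simp add: mult_ac)
        qed simp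
        also have "g ^ k * q k + \<dots>
            = g ^ k * (q k + g * (\<Sum>j\<in>{Suc k..<m}. g ^ (j - Suc k) * q j))"
          by (simp add: distrib_left sum_distrib_left)
        finally have "g ^ k * (q k + g * (\<Sum>j\<in>{Suc k..<m}. g ^ (j - Suc k) * q j)) \<in> P"
          using c sum by simp
        then have "q k + g * (\<Sum>j\<in>{Suc k..<m}. g ^ (j - Suc k) * q j) \<in> P"
          using g prime_ideal_power[OF P] by (auto simp: prime_ideal_mult[OF P])
        then have "q k + g * (\<Sum>j\<in>{Suc k..<m}. g ^ (j - Suc k) * q j) \<in> P'"
          using \<open>P \<subset> P'\<close> by blast
        from ideal_set_diff[OF id' this ideal_set_mult'[OF id' g(1),
            of "\<Sum>j\<in>{Suc k..<m}. g ^ (j - Suc k) * q j"]]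
        have "q k \<in> P'" by simp
        then show ?case using indep unfolding independent_mod_def q_def
          by (auto dest!: spec[of _ "\<lambda>i. c (k # i)"])
      qed
      show "c i = 0" using i zero by (auto simp: I'_def)
    qed
    moreover have "finite I'" using I by (simp add: I'_def)
    ultimately show ?thesis by blast
  qed
  then show ?thesis unfolding growth_def by blast
qed

text \<open>
  Exponents up to \<open>D * m\<close> leave room for only \<open>(D * m + 1) ^ N\<close> independent polynomials in
  \<open>N\<close> variables, which for large \<open>m\<close> is less than \<open>m ^ (N + 1)\<close>.
\<close>

lemma growth_le:
  assumes P: "prime_ideal P" and "growth d (P :: 'v::finite cpoly set)"
  shows "d \<le> CARD('v)"
proof (rule ccontr)
  assume "\<not> d \<le> CARD('v)"
  then have d: "CARD('v) < d" by simp
  obtain D where D: "\<exists>(I :: nat list set) w. finite I \<and> card I = m ^ d \<and>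
      (\<forall>i\<in>I. exponents_bounded (D * m) (w i)) \<and> independent_mod P I w" for m
    using assms unfolding growth_def by blast
  \<comment> \<open>large enough for \<open>(D * m + 1) ^ N < m ^ (N + 1)\<close>, where \<open>N\<close> is the number of variables\<close>
  define m where "m = (D + 1) ^ CARD('v) + 1"
  have m: "m \<ge> 1" by (simp add: m_def)
  obtain I :: "nat list set" and w where I: "finite I" "card I = m ^ d"
    and w: "\<And>i. i \<in> I \<Longrightarrow> exponents_bounded (D * m) (w i)" and indep: "independent_mod P I w"
    using D[of m] by blast
  define E where "E = {e :: 'v \<Rightarrow>\<^sub>0 nat. \<forall>v. Poly_Mapping.lookup e v \<le> D * m}"
  have inj: "inj_on Poly_Mapping.lookup E" by (auto simp: inj_on_def intro: poly_mapping_eqI)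
  have sub: "Poly_Mapping.lookup ` E \<subseteq> (\<Pi>\<^sub>E v\<in>UNIV. {..D * m})" by (auto simp: E_def)
  have fin: "finite (\<Pi>\<^sub>E v\<in>(UNIV :: 'v set). {..D * m})" by (rule finite_PiE) auto
  have "finite E" using finite_imageD[OF finite_subset[OF sub fin] inj] .
  have "card E = card (Poly_Mapping.lookup ` E)" by (simp add: card_image[OF inj])
  also have "\<dots> \<le> card (\<Pi>\<^sub>E v\<in>(UNIV :: 'v set). {..D * m})" by (rule card_mono[OF fin sub])
  also have "\<dots> = (D * m + 1) ^ CARD('v)" by (simp add: card_PiE)
  also have "\<dots> \<le> ((D + 1) * m) ^ CARD('v)" using m by (intro power_mono) auto
  also have "\<dots> = (D + 1) ^ CARD('v) * m ^ CARD('v)" by (rule power_mult_distrib)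
  also have "\<dots> < m * m ^ CARD('v)" using m by (intro mult_strict_right_mono) (auto simp: m_def)
  also have "\<dots> = m ^ Suc CARD('v)" by simp
  also have "\<dots> \<le> m ^ d" using d m by (intro power_increasing) auto
  finally have "card E < card I" using I by simp
  from linear_dependence_mod_prime[OF prime_ideal_complex_zero \<open>finite E\<close> \<open>finite I\<close> this,
      of "\<lambda>i e. Poly_Mapping.lookup (w i) e"]
  obtain c where c: "\<exists>i\<in>I. c i \<noteq> 0"
    and sum: "\<And>e. e \<in> E \<Longrightarrow> (\<Sum>i\<in>I. c i * Poly_Mapping.lookup (w i) e) = 0" by auto
  have lookup_const_mult: "Poly_Mapping.lookup (const a * p) e = a * Poly_Mapping.lookup p e"
    for a e and p :: "'v cpoly"
    by (simp add: const_def mult_map_scale_conv_mult[symmetric] Poly_Mapping.map.rep_eq when_def)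
  have "(\<Sum>i\<in>I. const (c i) * w i) = 0"
  proof (rule poly_mapping_eqI)
    fix e
    have "(\<Sum>i\<in>I. c i * Poly_Mapping.lookup (w i) e) = 0"
    proof (cases "e \<in> E")
      case False
      then have "Poly_Mapping.lookup (w i) e = 0" if "i \<in> I" for i
        using w[OF that] by (auto simp: E_def exponents_bounded_def in_keys_iff)
      then show ?thesis by simp
    qed (rule sum)
    then show "Poly_Mapping.lookup (\<Sum>i\<in>I. const (c i) * w i) e = Poly_Mapping.lookup 0 e"
      by (simp add: lookup_sum lookup_const_mult)
  qed
  then have "(\<Sum>i\<in>I. const (c i) * w i) \<in> P"
    using ideal_set_zero[OF prime_ideal_ideal[OF P]] by simp
  then show False using indep c unfolding independent_mod_def by blast
qed

lemma has_chain_growth: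
  assumes "has_chain k P" "growth d (P :: 'v::finite cpoly set)"
  shows "k + d \<le> CARD('v)"
proof -
  obtain C where C: "\<And>i. i \<le> k \<Longrightarrow> prime_ideal (C i)" "\<And>i. i < k \<Longrightarrow> C i \<subset> C (Suc i)" "C k = P"
    using assms(1) unfolding has_chain_def by blast
  have "growth (i + d) (C (k - i))" if "i \<le> k" for i
    using that
  proof (induction i)
    case 0
    then show ?case using assms C by simp
  next
    case (Suc i)
    have "Suc (k - Suc i) = k - i" using Suc.prems by simp
    then show ?case
      using growth_Suc[of "C (k - Suc i)" "C (k - i)" "i + d"] C(1)[of "k - Suc i"]
        C(1)[of "k - i"] C(2)[of "k - Suc i"] Suc by simp
  qed
  from this[of k] show ?thesis using growth_le[of "C 0"] C(1)[of 0] by simp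
qed

section \<open>Bounding heights from below by eliminating variables\<close>

definition split_var :: "'v::finite \<Rightarrow> 'v cpoly \<Rightarrow> 'v cpoly poly"
  where "split_var v = insertion (\<lambda>c. [:const c:]) (\<lambda>w. if w = v then [:0, 1:] else [:var w:])"

definition free_of :: "'v::finite \<Rightarrow> 'v cpoly \<Rightarrow> bool"
  where "free_of v p \<longleftrightarrow> split_var v p = [:p:]"

text \<open>
  This is the extension of the elimination ideal \<open>P \<inter> \<complex>[all variables except v]\<close> to the whole
  ring; describing it by coefficients makes it visibly a preimage of a prime.
\<close>

definition contract :: "'v::finite \<Rightarrow> 'v cpoly set \<Rightarrow> 'v cpoly set"
  where "contract v P = {p. \<forall>k. Polynomial.coeff (split_var v p) k \<in> P}"

lemma comm_ring_hom_split_var: "comm_ring_hom (split_var v)"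
  unfolding split_var_def by (intro comm_ring_hom_insertion comm_ring_hom_pCons comm_ring_hom_const)

lemmas split_var_simps = comm_ring_hom_simps[OF comm_ring_hom_split_var]

lemma split_var_const [simp]: "split_var v (const c) = [:const c:]"
  and split_var_var: "split_var v (var w) = (if w = v then [:0, 1:] else [:var w:])"
  by (simp_all add: split_var_def insertion_const insertion_var comm_ring_hom_pCons
      comm_ring_hom_const)

lemma comm_ring_hom_poly: "comm_ring_hom (\<lambda>p. poly p a)"
  by (simp add: comm_ring_hom_def)

lemma poly_split_var: "poly (split_var v p) (var v) = p"
  by (rule comm_ring_hom_eqI[OF comm_ring_hom_comp[OF comm_ring_hom_poly comm_ring_hom_split_var]
      comm_ring_hom_id])
    (auto simp: split_var_var)

lemma
  shows free_of_const: "free_of v (const c)" and free_of_var: "w \<noteq> v \<Longrightarrow> free_of v (var w)"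
    and free_of_add: "free_of v p \<Longrightarrow> free_of v q \<Longrightarrow> free_of v (p + q)"
    and free_of_diff: "free_of v p \<Longrightarrow> free_of v q \<Longrightarrow> free_of v (p - q)"
    and free_of_mult: "free_of v p \<Longrightarrow> free_of v q \<Longrightarrow> free_of v (p * q)"
  by (simp_all add: free_of_def split_var_var split_var_simps)

lemma free_of_0: "free_of v 0"
  using free_of_const[of v 0] by simp

lemma free_of_sum: "(\<And>x. x \<in> A \<Longrightarrow> free_of v (g x)) \<Longrightarrow> free_of v (sum g A)"
  by (induction A rule: infinite_finite_induct) (auto simp: free_of_add free_of_0)

lemma free_of_incl: "free_of (Inl i) (incl p)"
  by (induction p rule: cpoly_induct)
    (auto simp: incl_simps free_of_const free_of_var free_of_add free_of_mult)

lemma prime_ideal_coeffs: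
  assumes P: "prime_ideal (P :: 'a::comm_ring_1 set)"
  shows "prime_ideal {q. \<forall>k. Polynomial.coeff q k \<in> P}"
proof -
  note id = prime_ideal_ideal[OF P]
  let ?Q = "{q. \<forall>k. Polynomial.coeff q k \<in> P}"
  have "ideal_set ?Q"
    unfolding ideal_set_def
    by (auto simp: coeff_mult ideal_set_zero[OF id]
        intro: ideal_set_add[OF id] ideal_set_mult[OF id] ideal_set_sum[OF id])
  moreover have "1 \<notin> ?Q"
    using prime_ideal_one[OF P] by (auto intro!: exI[of _ 0])
  moreover have "p \<in> ?Q \<or> q \<in> ?Q" if pq: "p * q \<in> ?Q" for p q
  proof (rule ccontr)
    assume "\<not> (p \<in> ?Q \<or> q \<in> ?Q)"
    then have ex: "\<exists>i. Polynomial.coeff p i \<notin> P" "\<exists>i. Polynomial.coeff q i \<notin> P" by auto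
    \<comment> \<open>the lowest coefficients outside \<open>P\<close> multiply to a coefficient of the product\<close>
    define i where "i = (LEAST i. Polynomial.coeff p i \<notin> P)"
    define j where "j = (LEAST i. Polynomial.coeff q i \<notin> P)"
    have i: "Polynomial.coeff p i \<notin> P" and j: "Polynomial.coeff q j \<notin> P"
      unfolding i_def j_def using LeastI_ex[OF ex(1)] LeastI_ex[OF ex(2)] by auto
    have lt: "Polynomial.coeff p k \<in> P" if "k < i" for k
      using not_less_Least[of k "\<lambda>i. Polynomial.coeff p i \<notin> P"] that unfolding i_def by auto
    have lt': "Polynomial.coeff q k \<in> P" if "k < j" for k
      using not_less_Least[of k "\<lambda>i. Polynomial.coeff q i \<notin> P"] that unfolding j_def by auto
    let ?t = "\<lambda>k. Polynomial.coeff p k * Polynomial.coeff q (i + j - k)"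
    have "(\<Sum>k\<in>{..i + j} - {i}. ?t k) \<in> P"
    proof (rule ideal_set_sum[OF id])
      fix k assume "k \<in> {..i + j} - {i}"
      then have "k < i \<or> i + j - k < j" by auto
      then show "?t k \<in> P"
        using lt lt' ideal_set_mult[OF id] ideal_set_mult'[OF id] by blast
    qed
    moreover have "Polynomial.coeff (p * q) (i + j) = ?t i + (\<Sum>k\<in>{..i + j} - {i}. ?t k)"
      unfolding coeff_mult by (subst sum.remove[of _ i]) auto
    moreover have "Polynomial.coeff (p * q) (i + j) \<in> P" using pq by simp
    ultimately have "?t i \<in> P"
      using ideal_set_diff[OF id] by (metis add_diff_cancel_right')
    then show False using i j by (simp add: prime_ideal_mult[OF P])
  qed
  ultimately show ?thesis unfolding prime_ideal_iff by blast
qed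

lemma prime_ideal_contract:
  assumes "prime_ideal P" shows "prime_ideal (contract v P)"
proof -
  have "contract v P = split_var v -` {q. \<forall>k. Polynomial.coeff q k \<in> P}"
    by (auto simp: contract_def)
  then show ?thesis
    using prime_ideal_vimage[OF comm_ring_hom_split_var prime_ideal_coeffs[OF assms]] by simp
qed

lemma contract_subset:
  assumes "prime_ideal P" shows "contract v P \<subseteq> P"
proof
  fix p assume p: "p \<in> contract v P"
  have "poly (split_var v p) (var v) \<in> P"
    unfolding poly_altdef using p
    by (intro ideal_set_sum ideal_set_mult' prime_ideal_ideal[OF assms]) (auto simp: contract_def)
  then show "p \<in> P" by (simp add: poly_split_var)
qed

lemma free_of_contract_iff:
  assumes "prime_ideal P" "free_of v p" shows "p \<in> contract v P \<longleftrightarrow> p \<in> P"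
  using assms ideal_set_zero[OF prime_ideal_ideal[OF assms(1)]]
  by (auto simp: contract_def free_of_def coeff_pCons split: nat.splits)

text \<open>
  Linear relations in \<open>P\<close> among the variables of \<open>E\<close>, independent modulo \<open>P\<close>, produce
  equally many strict inclusions of primes below \<open>P\<close>. A relation with a coefficient outside
  \<open>P\<close> at a variable \<open>v\<close> cannot lie in the contraction of \<open>P\<close> along \<open>v\<close>. The other
  relations, freed of \<open>v\<close> by cross-multiplication, do lie there and remain independent, so the
  process can be repeated. What does not involve the variables of \<open>E\<close> is unaffected, which
  later allows a second run with other variables.
\<close>

lemma chain_of_linear_relations:
  fixes P :: "'v::finite cpoly set" and g :: "'j \<Rightarrow> 'v \<Rightarrow> 'v cpoly"
  assumes "prime_ideal P" "finite M"
    and "\<And>j v e. j \<in> M \<Longrightarrow> v \<in> E \<Longrightarrow> e \<in> E \<Longrightarrow> free_of v (g j e)"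
    and "\<And>j. j \<in> M \<Longrightarrow> (\<Sum>e\<in>E. g j e * var e) \<in> P"
    and "\<And>r. (\<And>j v. j \<in> M \<Longrightarrow> v \<in> E \<Longrightarrow> free_of v (r j)) \<Longrightarrow>
      (\<And>e. e \<in> E \<Longrightarrow> (\<Sum>j\<in>M. r j * g j e) \<in> P) \<Longrightarrow> (\<And>j. j \<in> M \<Longrightarrow> r j \<in> P)"
  shows "\<exists>P0. prime_ideal P0 \<and> (\<forall>p. (\<forall>v\<in>E. free_of v p) \<longrightarrow> (p \<in> P0 \<longleftrightarrow> p \<in> P)) \<and>
    (\<forall>k. has_chain k P0 \<longrightarrow> has_chain (k + card M) P)"
  using assms(2,1,3-)
proof (induction M arbitrary: P g rule: finite_induct)
  case empty
  then show ?case by auto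
next
  case (insert j M)
  note P = insert.prems(1) and free = insert.prems(2) and rel = insert.prems(3)
    and indep = insert.prems(4)
  note id = prime_ideal_ideal[OF P]
  \<comment> \<open>otherwise the coefficient family that is 1 at \<open>j\<close> and 0 elsewhere violates independence\<close>
  have "\<exists>v\<in>E. g j v \<notin> P"
  proof (rule ccontr)
    assume "\<not> (\<exists>v\<in>E. g j v \<notin> P)"
    then have "(if j = j then 1 else 0) \<in> P"
      using insert.hyps
      by (intro indep[of "\<lambda>i. if i = j then 1 else 0" j])
        (auto simp: if_distrib[of "\<lambda>x. x * _"] sum.delta free_of_0 ideal_set_zero[OF id]
          intro: free_of_const[of _ 1, simplified]
              intro!: ideal_set_add[OF id] ideal_set_sum[OF id])
    then show False using prime_ideal_one[OF P] by simp
  qed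
  then obtain v where v: "v \<in> E" "g j v \<notin> P" by blast
  have fin: "finite E" by simp
  define P' where "P' = contract v P"
  define g' where "g' i e = g j v * g i e - g i v * g j e" for i e
  have P': "prime_ideal P'" unfolding P'_def by (rule prime_ideal_contract[OF P])
  have sub: "P' \<subseteq> P" unfolding P'_def by (rule contract_subset[OF P])
  have iff: "p \<in> P' \<longleftrightarrow> p \<in> P" if "free_of v p" for p
    unfolding P'_def by (rule free_of_contract_iff[OF P that])
  have free': "free_of w (g' i e)" if "i \<in> M" "w \<in> E" "e \<in> E" for i w e
    unfolding g'_def using that free v by (intro free_of_diff free_of_mult) auto
  have g'v: "g' i v = 0" for i by (simp add: g'_def mult.commute)
  have "\<exists>P0. prime_ideal P0 \<and> (\<forall>p. (\<forall>v\<in>E. free_of v p) \<longrightarrow> (p \<in> P0 \<longleftrightarrow> p \<in> P')) \<and>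
    (\<forall>k. has_chain k P0 \<longrightarrow> has_chain (k + card M) P')"
  proof (rule insert.IH[OF P', of g'])
    fix i w e assume "i \<in> M" "w \<in> E" "e \<in> E"
    then show "free_of w (g' i e)" by (rule free')
  next
    fix i assume i: "i \<in> M"
    have "(\<Sum>e\<in>E. g' i e * var e) = g j v * (\<Sum>e\<in>E. g i e * var e) - g i v * (\<Sum>e\<in>E. g j e * var e)"
      by (simp add: g'_def sum_distrib_left left_diff_distrib sum_subtractf mult.assoc)
    also have "\<dots> \<in> P"
      by (intro ideal_set_diff[OF id] ideal_set_mult[OF id] rel) (use i in auto)
    finally have "(\<Sum>e\<in>E. g' i e * var e) \<in> P" .
    moreover have "free_of v (\<Sum>e\<in>E. g' i e * var e)"
    proof (rule free_of_sum)
      fix e assume "e \<in> E"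
      then show "free_of v (g' i e * var e)"
        by (cases "e = v") (use i v free' in \<open>auto simp: g'v free_of_0 intro!: free_of_mult free_of_var\<close>)
    qed
    ultimately show "(\<Sum>e\<in>E. g' i e * var e) \<in> P'" by (simp add: iff)
  next
    fix r i
    assume r: "\<And>i w. i \<in> M \<Longrightarrow> w \<in> E \<Longrightarrow> free_of w (r i)"
      and sum: "\<And>e. e \<in> E \<Longrightarrow> (\<Sum>i\<in>M. r i * g' i e) \<in> P'" and i: "i \<in> M"
    define s where "s k = (if k = j then - (\<Sum>i\<in>M. r i * g i v) else r k * g j v)" for k
    have "s i \<in> P"
    proof (rule indep[of s])
      fix k w assume k: "k \<in> insert j M" and w: "w \<in> E"
      have "free_of w (0 - (\<Sum>i\<in>M. r i * g i v))"
        by (intro free_of_diff free_of_0 free_of_sum free_of_mult r free) (use v w in auto)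
      moreover have "free_of w (r k * g j v)" if "k \<noteq> j"
        by (intro free_of_mult r free) (use v w k that in auto)
      ultimately show "free_of w (s k)" by (auto simp: s_def)
    next
      fix e assume e: "e \<in> E"
      have "(\<Sum>k\<in>M. s k * g k e) = (\<Sum>k\<in>M. r k * (g j v * g k e))"
        by (rule sum.cong) (use insert.hyps in \<open>auto simp: s_def mult.assoc\<close>)
      then have "(\<Sum>k\<in>insert j M. s k * g k e) = (\<Sum>i\<in>M. r i * g' i e)"
        using insert.hyps
        by (simp add: s_def g'_def right_diff_distrib sum_subtractf sum_distrib_right mult.assoc)
      then show "(\<Sum>k\<in>insert j M. s k * g k e) \<in> P" using sum[OF e] sub by auto
    qed (use i in auto)
    moreover have "i \<noteq> j" using i insert.hyps by auto
    ultimately have "r i \<in> P"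
      using v by (simp add: s_def prime_ideal_mult[OF P])
    then show "r i \<in> P'" using iff r i v by blast
  qed
  then obtain P0 where P0: "prime_ideal P0" "\<And>p. \<forall>v\<in>E. free_of v p \<Longrightarrow> p \<in> P0 \<longleftrightarrow> p \<in> P'"
    "\<And>k. has_chain k P0 \<Longrightarrow> has_chain (k + card M) P'" by blast
  \<comment> \<open>the coefficient of \<open>v\<close> in the relation \<open>j\<close> is the pivot\<close>
  have "(\<Sum>e\<in>E. g j e * var e) \<notin> P'"
  proof
    assume "(\<Sum>e\<in>E. g j e * var e) \<in> P'"
    then have "Polynomial.coeff (split_var v (\<Sum>e\<in>E. g j e * var e)) 1 \<in> P"
      by (simp add: P'_def contract_def)
    moreover have "Polynomial.coeff (split_var v (g j e * var e)) 1 = (if e = v then g j v else 0)"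
      if "e \<in> E" for e
      using free[of j v e] that v
      by (auto simp: free_of_def split_var_simps split_var_var coeff_pCons)
    then have "Polynomial.coeff (split_var v (\<Sum>e\<in>E. g j e * var e)) 1
        = (\<Sum>e\<in>E. if e = v then g j v else 0)"
      unfolding comm_ring_hom_sum[OF comm_ring_hom_split_var] coeff_sum by (rule sum.cong[OF refl])
    ultimately show False using v by (simp add: sum.delta)
  qed
  then have strict: "P' \<subset> P" using rel[of j] sub by auto
  show ?case
  proof (intro exI[of _ P0] conjI allI impI)
    fix k assume "has_chain k P0"
    from has_chain_Suc[OF P0(3)[OF this] strict P]
    show "has_chain (k + card (insert j M)) P" using insert.hyps by simp
  next
    fix p assume p: "\<forall>v\<in>E. free_of v p"
    then show "p \<in> P0 \<longleftrightarrow> p \<in> P" using P0(2) iff v by auto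
  qed (rule P0(1))
qed

section \<open>Linear forms\<close>

lemma linear_form_add: "linear_form (c + d) = linear_form c + linear_form d"
  by (simp add: linear_form_def const_add distrib_right sum.distrib)

lemma linear_form_scale: "linear_form (a *s c) = const a * linear_form c"
  by (simp add: linear_form_def const_mult sum_distrib_left mult.assoc)

lemma linear_form_0 [simp]: "linear_form 0 = 0"
  by (simp add: linear_form_def)

lemma linear_form_sum: "linear_form (sum g A) = (\<Sum>x\<in>A. linear_form (g x))"
  by (induction A rule: infinite_finite_induct) (auto simp: linear_form_add)

lemma linear_form_diff: "linear_form (c - d) = linear_form c - linear_form d"
  using linear_form_add[of "c - d" d] by (simp add: eq_diff_eq)

lemma linear_form_axis: "linear_form (axis j 1) = var j"
proof -
  have "linear_form (axis j 1) = (\<Sum>k\<in>UNIV. if k = j then var k else 0)"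
    unfolding linear_form_def by (rule sum.cong) (auto simp: axis_def)
  then show ?thesis by simp
qed

lemma single_1_eq_iff:
  "Poly_Mapping.single v (Suc 0) = Poly_Mapping.single w (Suc 0) \<longleftrightarrow> v = w"
  by (metis lookup_single_eq lookup_single_not_eq nat.simps(3))

lemma lookup_linear_form:
  "Poly_Mapping.lookup (linear_form c) (Poly_Mapping.single j 1) = c $ j"
proof -
  have "Poly_Mapping.lookup (linear_form c) (Poly_Mapping.single j 1)
      = (\<Sum>k\<in>UNIV. if k = j then c $ k else 0)"
    unfolding linear_form_def lookup_sum
    by (rule sum.cong)
      (auto simp: const_def var_def mult_single lookup_single when_def single_1_eq_iff)
  then show ?thesis by simp
qed

lemma linear_form_eq_0_iff: "linear_form c = 0 \<longleftrightarrow> c = 0"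
proof
  assume "linear_form c = 0"
  then show "c = 0" using lookup_linear_form[of c] by (simp add: vec_eq_iff)
qed simp

text \<open>
  The substitution \<open>\<rho>\<close> solves the equation \<open>linear_form c = 0\<close> for the variable \<open>v\<close>. It
  changes a polynomial only by multiples of the form and kills the form itself, so the multiples
  of the form are its kernel. As \<open>\<rho>\<close> maps into a domain, linear forms are prime.
\<close>

lemma dvd_linear_form_elimination:
  fixes c :: "complex ^ 'l::finite"
  assumes v: "c $ v \<noteq> 0"
  defines "\<rho> \<equiv> subst (\<lambda>w. if w = v then var v - const (1 / c $ v) * linear_form c else var w)"
  shows "linear_form c dvd p \<longleftrightarrow> \<rho> p = 0"
    and "\<rho> (linear_form d) = linear_form (d - (d $ v / c $ v) *s c)"
proof -
  have hom: "comm_ring_hom \<rho>" unfolding \<rho>_def by (rule comm_ring_hom_subst)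
  have \<rho>_const: "\<rho> (const a) = const a" for a
    by (simp add: \<rho>_def insertion_const[OF comm_ring_hom_const])
  have \<rho>_var: "\<rho> (var w) = (if w = v then var v - const (1 / c $ v) * linear_form c else var w)"
      for w
    by (simp add: \<rho>_def insertion_var[OF comm_ring_hom_const])
  have \<rho>: "\<rho> (linear_form d) = linear_form (d - (d $ v / c $ v) *s c)" for d
  proof -
    have "\<rho> (linear_form d) = (\<Sum>w\<in>UNIV. const (d $ w) * var w
        - (if w = v then const (d $ v / c $ v) * linear_form c else 0))"
      unfolding linear_form_def[of d] comm_ring_hom_sum[OF hom]
      by (rule sum.cong)
        (auto simp: comm_ring_hom_mult[OF hom] \<rho>_const \<rho>_var right_diff_distrib
            mult.assoc[symmetric]
          simp flip: const_mult)
    then show ?thesis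
      by (simp add: sum_subtractf linear_form_diff linear_form_scale linear_form_def[of d])
  qed
  show "\<rho> (linear_form d) = linear_form (d - (d $ v / c $ v) *s c)" by (rule \<rho>)
  have "linear_form c dvd p - \<rho> p"
  proof (induction p rule: cpoly_induct)
    case (var w)
    then show ?case by (auto simp: \<rho>_var)
  next
    case (add p q)
    then have "linear_form c dvd (p - \<rho> p) + (q - \<rho> q)" by (rule dvd_add)
    then show ?case by (simp add: comm_ring_hom_add[OF hom] algebra_simps)
  next
    case (mult p q)
    then have "linear_form c dvd (p - \<rho> p) * q + \<rho> p * (q - \<rho> q)" by (intro dvd_add) auto
    then show ?case by (simp add: comm_ring_hom_mult[OF hom] algebra_simps)
  qed (simp add: \<rho>_const)
  moreover have "\<rho> (linear_form c) = 0" using v by (simp add: \<rho>)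
  ultimately show "linear_form c dvd p \<longleftrightarrow> \<rho> p = 0"
    by (auto simp: comm_ring_hom_mult[OF hom] elim!: dvdE)
qed

lemma prime_linear_form:
  fixes c :: "complex ^ 'l::finite"
  assumes "c \<noteq> 0" and "linear_form c dvd p * q"
  shows "linear_form c dvd p \<or> linear_form c dvd q"
proof -
  obtain v where "c $ v \<noteq> 0" using assms(1) by (auto simp: vec_eq_iff)
  from dvd_linear_form_elimination(1)[OF this] assms(2) show ?thesis
    by (simp add: comm_ring_hom_mult[OF comm_ring_hom_subst] cpoly_mult_eq_0_iff)
qed

lemma not_linear_form_dvd_1:
  fixes c :: "complex ^ 'l::finite"
  assumes "c \<noteq> 0" shows "\<not> linear_form c dvd 1"
proof -
  obtain v where "c $ v \<noteq> 0" using assms(1) by (auto simp: vec_eq_iff)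
  from dvd_linear_form_elimination(1)[OF this] show ?thesis
    by (simp add: comm_ring_hom_1[OF comm_ring_hom_subst])
qed

lemma linear_form_dvd_linear_form:
  fixes c d :: "complex ^ 'l::finite"
  assumes "c \<noteq> 0" and "linear_form c dvd linear_form d"
  shows "\<exists>k. d = k *s c"
proof -
  obtain v where "c $ v \<noteq> 0" using assms(1) by (auto simp: vec_eq_iff)
  from dvd_linear_form_elimination[OF this] assms(2) show ?thesis
    by (auto simp: linear_form_eq_0_iff intro!: exI[of _ "d $ v / c $ v"])
qed

lemma prime_linear_form_prod:
  fixes c :: "complex ^ 'l::finite"
  assumes "c \<noteq> 0" and "linear_form c dvd prod g A"
  shows "\<exists>x\<in>A. linear_form c dvd g x"
  using assms(2)
  by (induction A rule: infinite_finite_induct)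
    (use assms(1) prime_linear_form[OF assms(1)] not_linear_form_dvd_1[OF assms(1)] in auto)

section \<open>Derivations\<close>

context
  fixes \<theta> :: "'v::finite cpoly \<Rightarrow> 'v cpoly"
  assumes \<theta>: "derivation \<theta>"
begin

lemma derivation_add: "\<theta> (p + q) = \<theta> p + \<theta> q"
  and derivation_scale: "\<theta> (const c * p) = const c * \<theta> p"
  and derivation_mult: "\<theta> (p * q) = \<theta> p * q + p * \<theta> q"
  using \<theta> by (auto simp: derivation_def)

lemma derivation_0: "\<theta> 0 = 0"
  using derivation_scale[of 0 0] by simp

lemma derivation_1: "\<theta> 1 = 0"
  using derivation_mult[of 1 1] by simp

lemma derivation_const: "\<theta> (const c) = 0"
  using derivation_scale[of c 1] by (simp add: derivation_1)

lemma derivation_sum: "\<theta> (sum g A) = (\<Sum>x\<in>A. \<theta> (g x))"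
  by (induction A rule: infinite_finite_induct) (auto simp: derivation_0 derivation_add)

lemma derivation_prod_eq_0: "(\<And>x. x \<in> A \<Longrightarrow> \<theta> (g x) = 0) \<Longrightarrow> \<theta> (prod g A) = 0"
  by (induction A rule: infinite_finite_induct) (auto simp: derivation_1 derivation_mult)

lemma derivation_linear_form: "\<theta> (linear_form c) = (\<Sum>j\<in>UNIV. const (c $ j) * \<theta> (var j))"
  by (simp add: linear_form_def derivation_sum derivation_scale)

end

lemma derivation_eqI:
  assumes "derivation \<theta>" "derivation \<eta>" "\<And>v. \<theta> (var v) = \<eta> (var v)"
  shows "\<theta> = (\<eta> :: 'v::finite cpoly \<Rightarrow> _)"
proof
  fix p show "\<theta> p = \<eta> p"
    by (induction p rule: cpoly_induct)
      (use assms in \<open>auto simp: derivation_const derivation_add derivation_mult\<close>)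
qed

lemma derivation_maps_0: "derivation 0"
  by (simp add: derivation_def)

lemma derivation_maps_add:
  fixes \<theta> \<eta> :: "'v::finite cpoly \<Rightarrow> 'v cpoly"
  shows "derivation \<theta> \<Longrightarrow> derivation \<eta> \<Longrightarrow> derivation (\<theta> + \<eta>)"
  unfolding derivation_def[of "\<theta> + \<eta>"]
  by (simp add: derivation_add derivation_mult derivation_const algebra_simps)

lemma derivation_scale_map:
  fixes \<theta> :: "'v::finite cpoly \<Rightarrow> 'v cpoly"
  shows "derivation \<theta> \<Longrightarrow> derivation (scale_map r \<theta>)"
  unfolding derivation_def[of "scale_map r \<theta>"]
  by (simp add: scale_map_def derivation_add derivation_mult derivation_const algebra_simps)

lemma sum_scale_map_apply: "(\<Sum>x\<in>A. scale_map (r x) (\<theta> x)) p = (\<Sum>x\<in>A. r x * \<theta> x p)"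
  by (induction A rule: infinite_finite_induct) (auto simp: scale_map_def)

lemma dvd_scale_map: "q dvd \<theta> p \<Longrightarrow> q dvd scale_map r \<theta> p"
  by (simp add: scale_map_def)

text \<open>
  The value is the coefficient of \<open>t\<close> in \<open>p (v + t * \<eta> v)\<close>; the Leibniz rule is then the formula
  for the linear coefficient of a product.
\<close>

definition derivation_of :: "('v::finite \<Rightarrow> 'v cpoly) \<Rightarrow> 'v cpoly \<Rightarrow> 'v cpoly"
  where "derivation_of \<eta> p = Polynomial.coeff
    (insertion (\<lambda>c. [:const c:]) (\<lambda>v. [:var v, \<eta> v:]) p) 1"

lemma coeff_mult_0: "Polynomial.coeff (p * q) 0 = Polynomial.coeff p 0 * Polynomial.coeff q 0"
  by (simp add: coeff_mult)

lemma coeff_mult_1: "Polynomial.coeff (p * q) (Suc 0)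
    = Polynomial.coeff p 0 * Polynomial.coeff q (Suc 0)
      + Polynomial.coeff p (Suc 0) * Polynomial.coeff q 0"
  by (simp add: coeff_mult)

lemma comm_ring_hom_coeff_0: "comm_ring_hom (\<lambda>p. Polynomial.coeff p 0)"
  by (simp add: comm_ring_hom_def coeff_mult_0)

lemma derivation_of_var: "derivation_of \<eta> (var v) = \<eta> v"
  by (simp add: derivation_of_def insertion_var comm_ring_hom_pCons comm_ring_hom_const)

lemma derivation_derivation_of: "derivation (derivation_of \<eta>)"
proof -
  let ?F = "insertion (\<lambda>c. [:const c:]) (\<lambda>v. [:var v, \<eta> v:])"
  have F: "comm_ring_hom ?F" by (intro comm_ring_hom_insertion comm_ring_hom_pCons
      comm_ring_hom_const)
  have F_const: "?F (const c) = [:const c:]" for c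
    by (simp add: insertion_const comm_ring_hom_pCons comm_ring_hom_const)
  have "Polynomial.coeff (?F p) 0 = p" for p
    by (rule comm_ring_hom_eqI[OF comm_ring_hom_comp[OF comm_ring_hom_coeff_0 F] comm_ring_hom_id])
      (auto simp: insertion_const insertion_var comm_ring_hom_pCons comm_ring_hom_const)
  then show ?thesis
    by (simp add: derivation_def derivation_of_def comm_ring_hom_add[OF F] comm_ring_hom_mult[OF F]
        F_const
        coeff_mult_1 coeff_pCons algebra_simps)
qed

section \<open>Logarithmic derivations of an arrangement\<close>

lemma log_derivations_iff:
  "\<theta> \<in> log_derivations f \<longleftrightarrow> derivation \<theta> \<and> defining_polynomial f dvd \<theta> (defining_polynomial f)"
  by (simp add: log_derivations_def mem_ideal_generated_singleton)

lemma subspace_log_derivations: "maps.subspace (log_derivations f)"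
  unfolding maps.subspace_def
  by (auto simp: log_derivations_iff derivation_maps_0 derivation_maps_add derivation_scale_map
      dvd_scale_map)

context
  fixes f :: "'n::finite \<Rightarrow> complex ^ 'l::finite"
  assumes arr: "central_arrangement f"
begin

lemma linear_form_neq_0: "linear_form (f i) \<noteq> 0"
  using arr by (simp add: central_arrangement_def linear_form_eq_0_iff)

text \<open>
  A form that divides another one is proportional to it and thus has the same kernel.
\<close>

lemma not_dvd_distinct:
  assumes "i \<noteq> k" shows "\<not> linear_form (f i) dvd linear_form (f k)"
proof
  assume "linear_form (f i) dvd linear_form (f k)"
  then obtain a where a: "f k = a *s f i"
    using linear_form_dvd_linear_form arr by (metis central_arrangement_def)
  moreover have "f k \<noteq> 0" using arr by (simp add: central_arrangement_def)
  ultimately have "a \<noteq> 0" by auto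
  then have "hyperplane (f k) = hyperplane (f i)"
    by (simp add: hyperplane_def a mult.assoc flip: sum_distrib_left)
  then show False using arr assms by (auto simp: central_arrangement_def inj_def)
qed

text \<open>
  Apply the Leibniz rule to \<open>Q = f\<^sub>i * R\<close>: the prime \<open>f\<^sub>i\<close> divides \<open>\<theta>(f\<^sub>i) * R\<close> but no
  factor of \<open>R\<close>.
\<close>

lemma linear_form_dvd_log_derivation:
  assumes "\<theta> \<in> log_derivations f"
  shows "linear_form (f i) dvd \<theta> (linear_form (f i))"
proof -
  let ?R = "\<Prod>k\<in>UNIV - {i}. linear_form (f k)"
  have \<theta>: "derivation \<theta>" using assms by (simp add: log_derivations_iff)
  have Q: "defining_polynomial f = linear_form (f i) * ?R"
    unfolding defining_polynomial_def by (rule prod.remove) auto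
  have "linear_form (f i) dvd \<theta> (linear_form (f i) * ?R)"
    using assms by (auto simp: log_derivations_iff Q elim: dvd_mult_left)
  then have "linear_form (f i) dvd \<theta> (linear_form (f i)) * ?R"
    by (simp add: derivation_mult[OF \<theta>] dvd_add_left_iff)
  moreover have "\<not> linear_form (f i) dvd ?R"
    using prime_linear_form_prod[of "f i" "\<lambda>k. linear_form (f k)" "UNIV - {i}"]
      not_dvd_distinct[of i] arr by (auto simp: central_arrangement_def)
  ultimately show ?thesis
    using prime_linear_form[of "f i"] arr by (auto simp: central_arrangement_def)
qed

text \<open>
  The forms outside \<open>A\<close> are constants for \<open>\<theta>\<close>, and the product of those in \<open>A\<close> supplies
  the factors of \<open>Q\<close> that \<open>\<theta>\<close> destroys. With all forms in \<open>A\<close> this shows that \<open>Q * \<theta>\<close>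
  is logarithmic for every \<open>\<theta>\<close>; fewer forms are possible for vector fields tangent to a flat.
\<close>

lemma log_derivation_of_vector_field:
  assumes \<theta>: "derivation \<theta>" and "\<And>i. i \<notin> A \<Longrightarrow> \<theta> (linear_form (f i)) = 0"
  shows "scale_map (\<Prod>i\<in>A. linear_form (f i)) \<theta> \<in> log_derivations f"
proof -
  let ?Q' = "\<Prod>i\<in>A. linear_form (f i)" and ?Q'' = "\<Prod>i\<in>- A. linear_form (f i)"
  have Q: "defining_polynomial f = ?Q' * ?Q''"
    unfolding defining_polynomial_def
    using prod.union_disjoint[of A "- A" "\<lambda>i. linear_form (f i)"] by simp
  have "\<theta> ?Q'' = 0" using assms(2) by (intro derivation_prod_eq_0[OF \<theta>]) auto
  then have "?Q' * \<theta> (?Q' * ?Q'') = (?Q' * ?Q'') * \<theta> ?Q'"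
    by (simp add: derivation_mult[OF \<theta>] mult_ac)
  then show ?thesis
    using derivation_scale_map[OF \<theta>] by (simp add: log_derivations_iff Q) (simp add: scale_map_def)
qed

definition log_quot :: "'n \<Rightarrow> ('l cpoly \<Rightarrow> 'l cpoly) \<Rightarrow> 'l cpoly"
  where "log_quot i \<theta> = exact_quot (\<theta> (linear_form (f i))) (linear_form (f i))"

lemma pairing_eq: "pairing f \<theta> = (\<Sum>i\<in>UNIV. var (Inl i) * incl (log_quot i \<theta>))"
  by (simp add: pairing_def log_quot_def)

lemma log_quot_mult:
  "\<theta> \<in> log_derivations f \<Longrightarrow> linear_form (f i) * log_quot i \<theta> = \<theta> (linear_form (f i))"
  unfolding log_quot_def
  by (rule exact_quot_cancel[OF linear_form_neq_0 linear_form_dvd_log_derivation])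

lemma log_quot_eqI:
  assumes "linear_form (f i) * q = \<theta> (linear_form (f i))"
  shows "log_quot i \<theta> = q"
  unfolding log_quot_def assms[symmetric] by (rule exact_quot_mult[OF linear_form_neq_0])

lemma log_quot_sum:
  assumes "\<And>x. x \<in> A \<Longrightarrow> \<theta> x \<in> log_derivations f"
  shows "log_quot i (\<Sum>x\<in>A. scale_map (r x) (\<theta> x)) = (\<Sum>x\<in>A. r x * log_quot i (\<theta> x))"
proof (rule log_quot_eqI)
  have "linear_form (f i) * (\<Sum>x\<in>A. r x * log_quot i (\<theta> x))
      = (\<Sum>x\<in>A. r x * (linear_form (f i) * log_quot i (\<theta> x)))"
    by (simp add: sum_distrib_left mult.left_commute)
  also have "\<dots> = (\<Sum>x\<in>A. scale_map (r x) (\<theta> x)) (linear_form (f i))"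
    unfolding sum_scale_map_apply by (rule sum.cong) (auto simp: log_quot_mult[OF assms])
  finally show "linear_form (f i) * (\<Sum>x\<in>A. r x * log_quot i (\<theta> x))
      = (\<Sum>x\<in>A. scale_map (r x) (\<theta> x)) (linear_form (f i))" .
qed

lemma pairing_sum:
  assumes "\<And>x. x \<in> A \<Longrightarrow> \<theta> x \<in> log_derivations f"
  shows "pairing f (\<Sum>x\<in>A. scale_map (r x) (\<theta> x)) = (\<Sum>x\<in>A. incl (r x) * pairing f (\<theta> x))"
  by (simp add: pairing_eq log_quot_sum[OF assms] incl_simps sum_distrib_left mult.left_commute)
    (rule sum.swap)

lemma defining_polynomial_neq_0: "defining_polynomial f \<noteq> 0"
  using prime_ideal_prod[OF prime_ideal_zero] linear_form_neq_0
  by (fastforce simp: defining_polynomial_def)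

end

section \<open>Essential arrangements\<close>

lemma essential_basis:
  fixes f :: "'n::finite \<Rightarrow> complex ^ 'l::finite"
  assumes "essential f"
  obtains J where "card J = CARD('l)" "\<And>d. \<exists>k. d = (\<Sum>j\<in>J. k j *s f j)"
proof -
  obtain J where J: "card J = CARD('l)" "inj_on f J" "vec.independent (f ` J)"
    using assms unfolding essential_def by blast
  have "UNIV \<subseteq> vec.span (f ` J)"
  proof (rule vec.card_ge_dim_independent[OF subset_UNIV J(3)])
    show "vec.dim (UNIV :: (complex ^ 'l) set) \<le> card (f ` J)"
      unfolding vec_dim_card card_image[OF J(2)] J(1) ..
  qed
  then have d: "\<exists>k. d = (\<Sum>j\<in>J. k j *s f j)" for d
  proof -
    have "d \<in> vec.span (f ` J)" using \<open>UNIV \<subseteq> _\<close> by blast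
    then obtain u where "d = (\<Sum>v\<in>f ` J. u v *s v)" by (auto simp: vec.span_finite)
    then have "d = (\<Sum>j\<in>J. u (f j) *s f j)" by (simp add: sum.reindex[OF J(2)])
    then show ?thesis by (intro exI[of _ "\<lambda>j. u (f j)"])
  qed
  show thesis by (rule that[OF J(1) d])
qed

lemma essential_spanning:
  fixes f :: "'n::finite \<Rightarrow> complex ^ 'l::finite"
  assumes "essential f"
  obtains k where "d = (\<Sum>i\<in>UNIV. k i *s f i)"
proof -
  obtain J where J: "\<And>d. \<exists>k. d = (\<Sum>j\<in>J. k j *s f j)" using essential_basis[OF assms] by metis
  obtain k where "d = (\<Sum>j\<in>J. k j *s f j)" using J by blast
  also have "\<dots> = (\<Sum>i\<in>UNIV. (if i \<in> J then k i else 0) *s f i)"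
    by (rule sum.mono_neutral_cong_left) auto
  finally show thesis by (rule that)
qed

lemma derivation_eqI_essential:
  fixes f :: "'n::finite \<Rightarrow> complex ^ 'l::finite"
  assumes "essential f" "derivation \<theta>" "derivation \<eta>"
    and "\<And>i. \<theta> (linear_form (f i)) = \<eta> (linear_form (f i))"
  shows "\<theta> = \<eta>"
proof (rule derivation_eqI[OF assms(2,3)])
  fix v
  obtain k where k: "axis v 1 = (\<Sum>i\<in>UNIV. k i *s f i)" using essential_spanning[OF assms(1)] .
  have "var v = (\<Sum>i\<in>UNIV. const (k i) * linear_form (f i))"
    unfolding linear_form_axis[symmetric] k by (simp add: linear_form_sum linear_form_scale)
  then show "\<theta> (var v) = \<eta> (var v)"
    using assms(2-4) by (simp add: derivation_sum derivation_scale)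
qed

lemma log_derivation_eqI:
  fixes f :: "'n::finite \<Rightarrow> complex ^ 'l::finite"
  assumes arr: "central_arrangement f" and ess: "essential f"
    and \<theta>: "\<theta> \<in> log_derivations f" and \<eta>: "\<eta> \<in> log_derivations f"
    and "\<And>i. log_quot f i \<theta> = log_quot f i \<eta>"
  shows "\<theta> = \<eta>"
proof (rule derivation_eqI_essential[OF ess])
  show "derivation \<theta>" "derivation \<eta>" using \<theta> \<eta> by (auto simp: log_derivations_iff)
  show "\<theta> (linear_form (f i)) = \<eta> (linear_form (f i))" for i
    unfolding log_quot_mult[OF arr \<theta>, symmetric] log_quot_mult[OF arr \<eta>, symmetric] assms(5) ..
qed

section \<open>The linear part of the logarithmic ideal\<close>

text \<open>
  The restriction of a polynomial to the \<open>a\<^sub>i\<close>-axis, as a polynomial in \<open>a\<^sub>i\<close> over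
  \<open>\<complex>[x\<^sub>1, \<dots>, x\<^sub>\<ell>]\<close>. Its linear coefficient recovers \<open>\<theta>(f\<^sub>i)/f\<^sub>i\<close> from the pairing of
  \<open>\<theta>\<close> with \<open>\<omega>\<^sub>a\<close>.
\<close>

definition jet :: "'n::finite \<Rightarrow> ('n + 'l::finite) cpoly \<Rightarrow> 'l cpoly poly"
  where "jet i = insertion (\<lambda>c. [:const c:])
    (case_sum (\<lambda>k. if k = i then [:0, 1:] else 0) (\<lambda>j. [:var j:]))"

lemma comm_ring_hom_jet: "comm_ring_hom (jet i)"
  unfolding jet_def by (intro comm_ring_hom_insertion comm_ring_hom_pCons comm_ring_hom_const)

lemma jet_simps [simp]:
  "jet i (const c) = [:const c:]" "jet i (var (Inl k)) = (if k = i then [:0, 1:] else 0)"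
  "jet i (var (Inr j)) = [:var j:]"
  by (simp_all add: jet_def insertion_const insertion_var comm_ring_hom_pCons comm_ring_hom_const)

lemma jet_incl: "jet i (incl p) = [:p:]"
  by (rule comm_ring_hom_eqI[OF comm_ring_hom_comp[OF comm_ring_hom_jet comm_ring_hom_incl]
      comm_ring_hom_pCons[OF comm_ring_hom_id]])
    auto

lemma jet_pairing:
  assumes "central_arrangement f"
  shows "jet i (pairing f \<theta>) = [:0, log_quot f i \<theta>:]"
proof -
  have "jet i (pairing f \<theta>) = (\<Sum>k\<in>UNIV. if k = i then [:0, log_quot f i \<theta>:] else 0)"
    unfolding pairing_eq[OF assms] comm_ring_hom_sum[OF comm_ring_hom_jet]
    by (rule sum.cong) (auto simp: comm_ring_hom_mult[OF comm_ring_hom_jet] jet_incl)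
  then show ?thesis by simp
qed

definition at_zero :: "('n::finite + 'l::finite) cpoly \<Rightarrow> 'l cpoly"
  where "at_zero = subst (case_sum (\<lambda>_. 0) var)"

lemma coeff_jet_0: "Polynomial.coeff (jet i s) 0 = at_zero s"
  unfolding at_zero_def
  by (rule comm_ring_hom_eqI[OF comm_ring_hom_comp[OF comm_ring_hom_coeff_0
      comm_ring_hom_jet] comm_ring_hom_subst])
    (auto simp: subst_simps split: sum.split)

lemma at_zero_incl: "at_zero (incl p) = p"
  by (simp add: jet_incl flip: coeff_jet_0[of undefined])

lemma incl_eq_0_iff: "incl p = (0 :: ('n::finite + 'l::finite) cpoly) \<longleftrightarrow> p = 0"
proof
  assume "incl p = (0 :: ('n + 'l) cpoly)"
  then have "at_zero (incl p :: ('n + 'l) cpoly) = at_zero (0 :: ('n + 'l) cpoly)" by simp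
  then show "p = 0" unfolding at_zero_incl by (simp add: at_zero_def subst_simps)
qed (simp add: incl_simps)

lemma pairing_inj:
  assumes "central_arrangement f" "essential f"
    and "\<theta> \<in> log_derivations f" "\<eta> \<in> log_derivations f" "pairing f \<theta> = pairing f \<eta>"
  shows "\<theta> = \<eta>"
proof (rule log_derivation_eqI[OF assms(1-4)])
  show "log_quot f i \<theta> = log_quot f i \<eta>" for i
    using assms(5) jet_pairing[OF assms(1), of i \<theta>] jet_pairing[OF assms(1), of i \<eta>] by simp
qed

lemma pairing_in_log_ideal: "\<theta> \<in> log_derivations f \<Longrightarrow> pairing f \<theta> \<in> log_ideal f"
  unfolding log_ideal_def by (rule ideal_generated_incl) simp

lemma ideal_log_ideal: "ideal_set (log_ideal f)"
  unfolding log_ideal_def by (rule ideal_generated_ideal)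

text \<open>
  The generators \<open>pairing f \<theta>\<close> are linear in the variables \<open>a\<^sub>i\<close>. Hence elements of the ideal
  vanish at \<open>a = 0\<close>, and taking linear parts there turns their coefficients into coefficients of a
  combination of logarithmic derivations.
\<close>

lemma log_derivation_of_log_ideal:
  fixes f :: "'n::finite \<Rightarrow> complex ^ 'l::finite"
  assumes arr: "central_arrangement f" and "s \<in> log_ideal f"
  obtains \<eta> where "\<eta> \<in> log_derivations f" "\<And>i. Polynomial.coeff (jet i s) 1 = log_quot f i \<eta>"
    and "at_zero s = 0"
proof -
  obtain T r where T: "finite T" "T \<subseteq> pairing f ` log_derivations f" "s = (\<Sum>g\<in>T. r g * g)"
    using assms(2) unfolding log_ideal_def by (rule mem_ideal_generatedE)
  have "\<forall>g\<in>T. \<exists>\<theta>. \<theta> \<in> log_derivations f \<and> g = pairing f \<theta>" using T(2) by blast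
  from bchoice[OF this] obtain \<theta> where \<theta>: "\<And>g. g \<in> T \<Longrightarrow> \<theta> g \<in> log_derivations f"
    "\<And>g. g \<in> T \<Longrightarrow> g = pairing f (\<theta> g)" by blast
  define \<eta> where "\<eta> = (\<Sum>g\<in>T. scale_map (at_zero (r g)) (\<theta> g))"
  have "\<eta> \<in> log_derivations f"
    unfolding \<eta>_def
    by (intro maps.subspace_sum[OF subspace_log_derivations]
        maps.subspace_scale[OF subspace_log_derivations] \<theta>)
  have jet_T: "jet i g = [:0, log_quot f i (\<theta> g):]" if "g \<in> T" for g i
    using jet_pairing[OF arr, of i "\<theta> g"] \<theta>(2)[OF that, symmetric] by simp
  have jet: "jet i s = (\<Sum>g\<in>T. jet i (r g) * [:0, log_quot f i (\<theta> g):])" for i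
    unfolding T(3) comm_ring_hom_sum[OF comm_ring_hom_jet]
    by (rule sum.cong) (auto simp: comm_ring_hom_mult[OF comm_ring_hom_jet] jet_T)
  have "log_quot f i \<eta> = (\<Sum>g\<in>T. at_zero (r g) * log_quot f i (\<theta> g))" for i
    unfolding \<eta>_def by (rule log_quot_sum[OF arr \<theta>(1)])
  moreover have "Polynomial.coeff (jet i s) 1 = (\<Sum>g\<in>T. at_zero (r g) * log_quot f i (\<theta> g))" for i
    by (simp add: jet coeff_sum coeff_mult_1 coeff_jet_0 mult.commute)
  moreover have "at_zero s = 0"
    unfolding coeff_jet_0[of undefined, symmetric] jet by (simp add: coeff_sum coeff_mult_0)
  ultimately show thesis using that \<open>\<eta> \<in> log_derivations f\<close> by simp
qed

text \<open>
  In a relation expressing a generator \<open>pairing f \<theta>\<close> through elements of the ideal, which all vanish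
  at \<open>a = 0\<close>, only the values of the coefficients at \<open>a = 0\<close> contribute to the linear part. So
  the linear parts of any generators of the ideal span the module of logarithmic derivations.
\<close>

lemma log_derivations_spanned_by_linear_parts:
  fixes f :: "'n::finite \<Rightarrow> complex ^ 'l::finite"
  assumes arr: "central_arrangement f" and ess: "essential f"
    and G: "finite G" "ideal_generated G = log_ideal f"
  obtains \<eta> where "maps.span (\<eta> ` G) = log_derivations f"
proof -
  have "\<forall>g\<in>G. \<exists>\<eta>. \<eta> \<in> log_derivations f
      \<and> (\<forall>i. Polynomial.coeff (jet i g) 1 = log_quot f i \<eta>) \<and> at_zero g = 0"
  proof
    fix g assume "g \<in> G"
    then have "g \<in> log_ideal f" using ideal_generated_incl[of g G] G(2) by simp
    then obtain \<eta> where "\<eta> \<in> log_derivations f"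
      "\<And>i. Polynomial.coeff (jet i g) 1 = log_quot f i \<eta>" "at_zero g = 0"
      using log_derivation_of_log_ideal[OF arr] by blast
    then show "\<exists>\<eta>. \<eta> \<in> log_derivations f
      \<and> (\<forall>i. Polynomial.coeff (jet i g) 1 = log_quot f i \<eta>) \<and> at_zero g = 0" by blast
  qed
  from bchoice[OF this] obtain \<eta> where \<eta>: "\<And>g. g \<in> G \<Longrightarrow> \<eta> g \<in> log_derivations f"
    "\<And>g i. g \<in> G \<Longrightarrow> Polynomial.coeff (jet i g) 1 = log_quot f i (\<eta> g)"
    "\<And>g. g \<in> G \<Longrightarrow> at_zero g = 0" by blast
  have sub: "maps.span (\<eta> ` G) \<subseteq> log_derivations f"
    by (rule maps.span_minimal[OF _ subspace_log_derivations]) (use \<eta> in auto)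
  have "\<theta> \<in> maps.span (\<eta> ` G)" if \<theta>: "\<theta> \<in> log_derivations f" for \<theta>
  proof -
    have "pairing f \<theta> \<in> ideal_generated G" using pairing_in_log_ideal[OF \<theta>] G(2) by simp
    from ideal_generated_finite[OF G(1) this]
    obtain r where r: "pairing f \<theta> = (\<Sum>g\<in>G. r g * g)" .
    define \<theta>' where "\<theta>' = (\<Sum>g\<in>G. scale_map (at_zero (r g)) (\<eta> g))"
    have span: "\<theta>' \<in> maps.span (\<eta> ` G)"
      unfolding \<theta>'_def by (intro maps.span_sum maps.span_scale maps.span_base) auto
    have "\<theta> = \<theta>'"
    proof (rule log_derivation_eqI[OF arr ess \<theta>])
      show "\<theta>' \<in> log_derivations f" using span sub by blast
      fix i
      have "log_quot f i \<theta> = Polynomial.coeff (jet i (pairing f \<theta>)) 1"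
        by (simp add: jet_pairing[OF arr])
      also have "\<dots> = (\<Sum>g\<in>G. at_zero (r g) * log_quot f i (\<eta> g))"
        using \<eta>(2,3)
        by (simp add: r comm_ring_hom_sum[OF comm_ring_hom_jet] comm_ring_hom_mult[OF
            comm_ring_hom_jet] coeff_sum
            coeff_mult_1 coeff_jet_0)
      also have "\<dots> = log_quot f i \<theta>'"
        unfolding \<theta>'_def by (rule log_quot_sum[OF arr \<eta>(1), symmetric])
      finally show "log_quot f i \<theta> = log_quot f i \<theta>'" .
    qed
    then show ?thesis using span by simp
  qed
  then show thesis using sub that by blast
qed

section \<open>The rank of the module of logarithmic derivations\<close>

definition coordinate_derivation :: "'v::finite \<Rightarrow> 'v cpoly \<Rightarrow> 'v cpoly"
  where "coordinate_derivation j = derivation_of (\<lambda>i. if i = j then 1 else 0)"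

lemma derivation_coordinate: "derivation (coordinate_derivation j)"
  unfolding coordinate_derivation_def by (rule derivation_derivation_of)

lemma coordinate_derivation_var: "coordinate_derivation j (var i) = (if i = j then 1 else 0)"
  by (simp add: coordinate_derivation_def derivation_of_var)

text \<open>
  A nonzero multiple of all derivations still has rank \<open>\<ell>\<close>, so it does not fit into a module
  with fewer than \<open>\<ell>\<close> generators.
\<close>

lemma card_ge_of_coordinate_derivations_in_span:
  fixes B :: "('l::finite cpoly \<Rightarrow> 'l cpoly) set"
  assumes "finite B" "c \<noteq> 0" and "\<And>j. scale_map c (coordinate_derivation j) \<in> maps.span B"
  shows "CARD('l) \<le> card B"
proof (rule ccontr)
  assume "\<not> CARD('l) \<le> card B"
  then have less: "card B < card (UNIV :: 'l set)" by simp
  have "\<forall>j. \<exists>g. scale_map c (coordinate_derivation j) = (\<Sum>b\<in>B. scale_map (g b) b)"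
    using assms(3) unfolding maps.span_finite[OF assms(1)] by blast
  from choice[OF this] obtain g where
    g: "\<And>j. scale_map c (coordinate_derivation j) = (\<Sum>b\<in>B. scale_map (g j b) b)" by blast
  obtain r where r: "\<exists>j\<in>UNIV. r j \<notin> {0}" "\<forall>b\<in>B. (\<Sum>j\<in>UNIV. r j * g j b) \<in> {0}"
    using linear_dependence_mod_prime[OF prime_ideal_zero assms(1) finite less, of g] by blast
  have "r k = 0" for k
  proof -
    have "(\<Sum>j\<in>UNIV. r j * scale_map c (coordinate_derivation j) (var k))
        = (\<Sum>b\<in>B. (\<Sum>j\<in>UNIV. r j * g j b) * b (var k))"
      unfolding g sum_scale_map_apply sum_distrib_left sum_distrib_right
      by (subst sum.swap) (simp add: mult.assoc)
    also have "\<dots> = 0" using r(2) by simp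
    finally have "(\<Sum>j\<in>UNIV. if k = j then r j * c else 0) = 0"
      by (simp add: scale_map_def coordinate_derivation_var if_distrib[of "\<lambda>x. _ * x"]
          cong: if_cong)
    then show ?thesis using assms(2) by (simp add: cpoly_mult_eq_0_iff)
  qed
  then show False using r(1) by simp
qed

text \<open>
  A derivation is determined by its \<open>\<ell>\<close> values on the variables.
\<close>

lemma card_independent_derivations_le:
  fixes B :: "('l::finite cpoly \<Rightarrow> 'l cpoly) set"
  assumes "maps.independent B" and der: "\<And>b. b \<in> B \<Longrightarrow> derivation b"
  shows "finite B \<and> card B \<le> CARD('l)"
proof (rule ccontr)
  assume "\<not> (finite B \<and> card B \<le> CARD('l))"
  then have "\<exists>T. T \<subseteq> B \<and> finite T \<and> card T = Suc CARD('l)"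
    using infinite_arbitrarily_large[of B "Suc CARD('l)"]
        obtain_subset_with_card_n[of "Suc CARD('l)" B]
    by (metis not_less_eq_eq)
  then obtain T where T: "T \<subseteq> B" "finite T" "card T = Suc CARD('l)" by blast
  then have "card (UNIV :: 'l set) < card T" by simp
  from linear_dependence_mod_prime[OF prime_ideal_zero finite T(2) this, of "\<lambda>b j. b (var j)"]
  obtain r where "(\<exists>b\<in>T. r b \<notin> {0}) \<and> (\<forall>j\<in>UNIV. (\<Sum>b\<in>T. r b * b (var j)) \<in> {0})"
    by (rule exE)
  then have r: "\<exists>b\<in>T. r b \<noteq> 0" "\<And>j. (\<Sum>b\<in>T. r b * b (var j)) = 0" by simp_all
  have "derivation (\<Sum>b\<in>T. scale_map (r b) b)"
    using T(1) der
    by (induction T rule: infinite_finite_induct)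
      (auto intro: derivation_maps_0 derivation_maps_add derivation_scale_map)
  then have "(\<Sum>b\<in>T. scale_map (r b) b) = 0"
    by (rule derivation_eqI[OF _ derivation_maps_0]) (simp add: sum_scale_map_apply r(2))
  then have "maps.dependent B" unfolding maps.dependent_explicit using T r(1) by blast
  then show False using assms(1) by blast
qed

lemma log_derivation_coordinate:
  "scale_map (defining_polynomial f) (coordinate_derivation j) \<in> log_derivations f"
  by (simp add: log_derivations_iff derivation_scale_map derivation_coordinate)
    (simp add: scale_map_def)

text \<open>
  A relation with a nonzero coefficient \<open>u\<close> at \<open>b\<close> brings \<open>u\<close> times the whole module, and in
  particular the derivations \<open>u * Q * \<partial>\<^sub>j\<close>, into the span of the other generators; but these are
  fewer than \<open>\<ell>\<close>.
\<close>

lemma independent_of_spanning_card_le: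
  fixes f :: "'n::finite \<Rightarrow> complex ^ 'l::finite"
  assumes arr: "central_arrangement f" and finB: "finite B" and cardB: "card B \<le> CARD('l)"
    and span: "maps.span B = log_derivations f"
  shows "maps.independent B"
proof
  assume "maps.dependent B"
  then obtain u b where b: "b \<in> B" "u b \<noteq> 0" and sum: "(\<Sum>b\<in>B. scale_map (u b) b) = 0"
    by (auto simp: maps.dependent_finite[OF finB])
  have "scale_map (u b) b = - (\<Sum>b\<in>B - {b}. scale_map (u b) b)"
    using sum b finB by (simp add: sum.remove eq_neg_iff_add_eq_0)
  also have "\<dots> \<in> maps.span (B - {b})"
    by (intro maps.span_neg maps.span_sum maps.span_scale maps.span_base)
  finally have ub: "scale_map (u b) b \<in> maps.span (B - {b})" .
  have in_span: "scale_map (u b) \<theta> \<in> maps.span (B - {b})" if "\<theta> \<in> maps.span B" for \<theta>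
  proof -
    have "maps.span B \<subseteq> {\<theta>. scale_map (u b) \<theta> \<in> maps.span (B - {b})}"
    proof (rule maps.span_minimal)
      show "B \<subseteq> {\<theta>. scale_map (u b) \<theta> \<in> maps.span (B - {b})}"
        using ub by (auto intro: maps.span_scale maps.span_base)
      show "maps.subspace {\<theta>. scale_map (u b) \<theta> \<in> maps.span (B - {b})}"
        unfolding maps.subspace_def
      proof (intro conjI allI ballI)
        fix c x assume "x \<in> {\<theta>. scale_map (u b) \<theta> \<in> maps.span (B - {b})}"
        then have "scale_map c (scale_map (u b) x) \<in> maps.span (B - {b})"
          by (intro maps.span_scale[where x = "scale_map (u b) x"]) simp
        then show "scale_map c x \<in> {\<theta>. scale_map (u b) \<theta> \<in> maps.span (B - {b})}"
          by (simp add: mult.commute)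
      qed (auto simp: maps.span_zero maps.scale_right_distrib intro: maps.span_add)
    qed
    then show ?thesis using that by blast
  qed
  have "scale_map (u b * defining_polynomial f) (coordinate_derivation j) \<in> maps.span (B - {b})"
    for j
    using in_span log_derivation_coordinate[of f j] by (simp add: span flip: maps.scale_scale)
  then have "CARD('l) \<le> card (B - {b})"
    using b finB defining_polynomial_neq_0[OF arr]
    by (intro card_ge_of_coordinate_derivations_in_span[of _ "u b * defining_polynomial f"])
      (auto simp: cpoly_mult_eq_0_iff)
  moreover have "card (B - {b}) < card B" using b finB by (intro psubset_card_mono) auto
  ultimately show False using cardB by simp
qed

section \<open>The codimension of the logarithmic ideal\<close>

text \<open>
  The indices in \<open>K\<close> are those of basis vectors in \<open>L\<close>; accordingly the dual basis vectors with
  index outside \<open>K\<close> form a basis of the annihilator of \<open>L\<close>.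
\<close>

lemma adapted_dual_bases:
  fixes L :: "(complex ^ 'l::finite) set"
  assumes "vec.subspace L"
  shows "\<exists>K (b :: 'l \<Rightarrow> complex ^ 'l) (v :: 'l \<Rightarrow> complex ^ 'l). (\<forall>k\<in>K. b k \<in> L)
    \<and> (\<forall>j k. (\<Sum>i\<in>UNIV. b j $ i * v k $ i) = (if j = k then 1 else 0))
    \<and> (\<forall>c\<in>L. \<forall>k. k \<notin> K \<longrightarrow> (\<Sum>i\<in>UNIV. c $ i * v k $ i) = 0)"
proof -
  obtain B0 where B0: "B0 \<subseteq> L" "vec.independent B0" "L \<subseteq> vec.span B0"
    using vec.basis_exists[of L] by metis
  define B where "B = vec.extend_basis B0"
  have B: "B0 \<subseteq> B" "vec.independent B" "vec.span B = UNIV"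
    unfolding B_def
    by (rule vec.extend_basis_superset[OF B0(2)] vec.independent_extend_basis[OF B0(2)]
        vec.span_extend_basis[OF B0(2)])+
  have finB: "finite B" using vec.finiteI_independent[OF B(2)] .
  have "card B = vec.dim (UNIV :: (complex ^ 'l) set)"
    by (rule vec.basis_card_eq_dim[OF subset_UNIV _ B(2)]) (simp add: B(3))
  then have cardB: "card B = CARD('l)" unfolding vec_dim_card .
  then obtain b :: "'l \<Rightarrow> complex ^ 'l" where b: "bij_betw b (UNIV :: 'l set) B"
    using finite_same_card_bij[of "UNIV :: 'l set" B] finB by auto
  define A where "A = (\<chi> i. b i)"
  have row: "row i A = b i" for i by (simp add: A_def row_def vec_eq_iff)
  have "\<exists>B. A ** B = mat 1"
    unfolding matrix_right_invertible_independent_rows row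
  proof (intro allI impI)
    fix c :: "'l \<Rightarrow> complex" and i
    assume "(\<Sum>i\<in>UNIV. c i *s b i) = 0"
    then have "(\<Sum>x\<in>B. c (inv_into UNIV b x) *s x) = 0"
      using b sum.reindex[of b UNIV "\<lambda>x. c (inv_into UNIV b x) *s x"]
      by (simp add: bij_betw_def)
    then have "c (inv_into UNIV b (b i)) = 0"
      using vec.independentD[OF B(2) finB subset_refl, of "\<lambda>x. c (inv_into UNIV b x)" "b i"] b
        by (auto simp: bij_betw_def)
    then show "c i = 0" using b inv_into_f_f[of b UNIV i] by (simp add: bij_betw_def)
  qed
  then obtain M :: "complex ^ 'l ^ 'l" where M: "A ** M = mat 1" by blast
  define v where "v k = (\<chi> i. M $ i $ k)" for k
  have dual: "(\<Sum>i\<in>UNIV. b j $ i * v k $ i) = (if j = k then 1 else 0)" for j k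
  proof -
    have "(A ** M) $ j $ k = (\<Sum>i\<in>UNIV. b j $ i * v k $ i)"
      by (simp add: matrix_matrix_mult_def A_def v_def)
    then show ?thesis by (simp add: M mat_def)
  qed
  define K where "K = {k. b k \<in> B0}"
  have sub: "vec.subspace {c :: complex ^ 'l. (\<Sum>i\<in>UNIV. c $ i * v k $ i) = 0}" for k
    by (auto simp: vec.subspace_def distrib_right sum.distrib
        mult.assoc simp flip: sum_distrib_left)
  have zero: "(\<Sum>i\<in>UNIV. c $ i * v k $ i) = 0" if "c \<in> L" "k \<notin> K" for c k
  proof -
    have "x \<in> {c :: complex ^ 'l. (\<Sum>i\<in>UNIV. c $ i * v k $ i) = 0}" if x: "x \<in> B0" for x
    proof -
      obtain j where j: "x = b j" using b B(1) x by (auto simp: bij_betw_def)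
      then have "j \<noteq> k" using x \<open>k \<notin> K\<close> by (auto simp: K_def)
      then show ?thesis by (simp add: j dual)
    qed
    then have "vec.span B0 \<subseteq> {c :: complex ^ 'l. (\<Sum>i\<in>UNIV. c $ i * v k $ i) = 0}"
      by (intro vec.span_minimal[OF _ sub]) blast
    then show ?thesis using B0(3) that by blast
  qed
  have "\<forall>k\<in>K. b k \<in> L" using B0(1) by (auto simp: K_def)
  then show ?thesis using dual zero by (intro exI[of _ K] exI[of _ b] exI[of _ v]) simp
qed

text \<open>
  The prime contains \<open>\<ell>\<close> independent linear relations. Let \<open>L\<close> be the space of
  linear forms in \<open>P\<close>, say of dimension \<open>k\<close>. The \<open>\<ell> - k\<close> independent constant vector fields
  that annihilate \<open>L\<close> become logarithmic after multiplication by the forms \<open>f\<^sub>i\<close> outside \<open>P\<close>,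
  and their pairings are \<open>\<ell> - k\<close> linear relations in \<open>P\<close> among the \<open>a\<^sub>i\<close>. These are independent
  modulo \<open>P\<close> since the \<open>f\<^sub>i\<close> span the space of all linear forms. The remaining \<open>k\<close> relations,
  among the \<open>x\<^sub>j\<close>, are the elements of a basis of \<open>L\<close>.
\<close>

lemma has_chain_of_log_ideal_subset:
  fixes f :: "'n::finite \<Rightarrow> complex ^ 'l::finite"
  assumes arr: "central_arrangement f" and ess: "essential f"
    and P: "prime_ideal P" and I: "log_ideal f \<subseteq> P"
  shows "has_chain CARD('l) P"
proof -
  note id = prime_ideal_ideal[OF P]
  define L where "L = {c. incl (linear_form c) \<in> P}"
  have "vec.subspace L"
    by (auto simp: L_def vec.subspace_def linear_form_add linear_form_scale incl_simps
        ideal_set_zero[OF id] intro: ideal_set_add[OF id] ideal_set_mult[OF id])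
  from adapted_dual_bases[OF this]
  obtain K and b v :: "'l \<Rightarrow> complex ^ 'l" where K: "(\<forall>k\<in>K. b k \<in> L)
    \<and> (\<forall>j k. (\<Sum>i\<in>UNIV. b j $ i * v k $ i) = (if j = k then 1 else 0))
    \<and> (\<forall>c\<in>L. \<forall>k. k \<notin> K \<longrightarrow> (\<Sum>i\<in>UNIV. c $ i * v k $ i) = 0)"
    by (elim exE)
  have bL: "b k \<in> L" if "k \<in> K" for k using K that by blast
  have dual: "(\<Sum>i\<in>UNIV. b j $ i * v k $ i) = (if j = k then 1 else 0)" for j k
    using K by blast
  have zero: "(\<Sum>i\<in>UNIV. c $ i * v k $ i) = 0" if "c \<in> L" "k \<notin> K" for c k
    using K that by blast
  define Q' where "Q' = (\<Prod>i\<in>{i. f i \<notin> L}. linear_form (f i))"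
  have Q': "incl Q' \<notin> P"
    unfolding Q'_def comm_ring_hom_prod[OF comm_ring_hom_incl]
    using prime_ideal_prod[OF P] by (fastforce simp: L_def)
  \<comment> \<open>the constant vector fields \<open>\<delta> k\<close> with \<open>k \<notin> K\<close> are tangent to the common zeros of \<open>L\<close>\<close>
  define \<delta> where "\<delta> k = derivation_of (\<lambda>i. const (v k $ i))" for k
  have \<delta>: "derivation (\<delta> k)" for k unfolding \<delta>_def by (rule derivation_derivation_of)
  have \<delta>_form: "\<delta> k (linear_form c) = const (\<Sum>i\<in>UNIV. c $ i * v k $ i)" for k c
    by (simp add: derivation_linear_form[OF \<delta>] const_sum const_mult)
        (simp add: \<delta>_def derivation_of_var)
  define \<theta> where "\<theta> k = scale_map Q' (\<delta> k)" for k
  have \<theta>: "\<theta> k \<in> log_derivations f" if "k \<notin> K" for k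
    unfolding \<theta>_def Q'_def
    by (rule log_derivation_of_vector_field[OF arr \<delta>]) (use zero that in \<open>auto simp: \<delta>_form\<close>)
  \<comment> \<open>the pairings of the \<open>\<theta> k\<close>, as relations among the variables \<open>a\<^sub>i\<close>\<close>
  define g :: "'l \<Rightarrow> 'n + 'l \<Rightarrow> ('n + 'l) cpoly"
    where "g k e = (case e of Inl i \<Rightarrow> incl (log_quot f i (\<theta> k)) | Inr _ \<Rightarrow> 0)" for k e
  have sum_Inl: "(\<Sum>e\<in>range Inl. F e) = (\<Sum>i\<in>UNIV. F (Inl i))" for F :: "'n + 'l \<Rightarrow> ('n + 'l) cpoly"
    by (simp add: sum.reindex)
  have sum_Inr: "(\<Sum>e\<in>range Inr. F e) = (\<Sum>i\<in>UNIV. F (Inr i))" for F :: "'n + 'l \<Rightarrow> ('n + 'l) cpoly"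
    by (simp add: sum.reindex)
  have "\<exists>P0. prime_ideal P0
    \<and> (\<forall>p. (\<forall>v\<in>range Inl. free_of v p) \<longrightarrow> (p \<in> P0 \<longleftrightarrow> p \<in> P))
    \<and> (\<forall>k. has_chain k P0 \<longrightarrow> has_chain (k + card (- K)) P)"
  proof (rule chain_of_linear_relations[OF P, of "- K" "range Inl" g])
    fix k and w e :: "'n + 'l" assume "w \<in> range Inl" "e \<in> range Inl"
    then show "free_of w (g k e)" by (auto simp: g_def free_of_incl)
  next
    fix k assume "k \<in> - K"
    have "(\<Sum>e\<in>range Inl. g k e * var e) = pairing f (\<theta> k)"
      by (simp add: sum_Inl g_def pairing_eq[OF arr] mult.commute)
    then show "(\<Sum>e\<in>range Inl. g k e * var e) \<in> P"
      using pairing_in_log_ideal[OF \<theta>] I \<open>k \<in> - K\<close> by auto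
  next
    fix r k
    assume r: "\<And>e. e \<in> range Inl \<Longrightarrow> (\<Sum>j\<in>- K. r j * g j e) \<in> P" and k: "k \<in> - K"
    have f: "(\<Sum>j\<in>- K. r j * const (\<Sum>m\<in>UNIV. f i $ m * v j $ m)) \<in> P" for i
    proof -
      have "incl Q' * (\<Sum>j\<in>- K. r j * const (\<Sum>m\<in>UNIV. f i $ m * v j $ m))
          = (\<Sum>j\<in>- K. r j * incl (\<theta> j (linear_form (f i))))"
        by (simp add: sum_distrib_left \<theta>_def scale_map_def \<delta>_form incl_simps mult_ac)
      also have "\<dots> = (\<Sum>j\<in>- K. r j * incl (linear_form (f i) * log_quot f i (\<theta> j)))"
        by (rule sum.cong) (auto simp: log_quot_mult[OF arr \<theta>])
      also have "\<dots> = incl (linear_form (f i)) * (\<Sum>j\<in>- K. r j * g j (Inl i))"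
        by (simp add: g_def sum_distrib_left incl_simps mult_ac)
      also have "\<dots> \<in> P" by (intro ideal_set_mult[OF id] r) auto
      finally show ?thesis using Q' by (simp add: prime_ideal_mult[OF P])
    qed
    obtain t where t: "b k = (\<Sum>i\<in>UNIV. t i *s f i)" using essential_spanning[OF ess] .
    have bt: "(\<Sum>m\<in>UNIV. b k $ m * v j $ m) = (\<Sum>i\<in>UNIV. t i * (\<Sum>m\<in>UNIV. f i $ m * v j $ m))"
      for j
      unfolding t by (simp add: sum_distrib_left sum_distrib_right mult.assoc) (rule sum.swap)
    have "r k = (\<Sum>j\<in>- K. if j = k then r j else 0)" using k by (simp add: sum.delta)
    also have "\<dots> = (\<Sum>j\<in>- K. r j * const (\<Sum>m\<in>UNIV. b k $ m * v j $ m))"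
      by (rule sum.cong) (auto simp: dual)
    also have "\<dots> = (\<Sum>i\<in>UNIV. const (t i) *
        (\<Sum>j\<in>- K. r j * const (\<Sum>m\<in>UNIV. f i $ m * v j $ m)))"
      unfolding bt const_sum const_mult sum_distrib_left
      by (subst sum.swap) (simp add: mult_ac)
    also have "\<dots> \<in> P" by (intro ideal_set_sum[OF id] ideal_set_mult[OF id] f)
    finally show "r k \<in> P" .
  qed simp
  then obtain P0 where P0: "prime_ideal P0"
    and P0_iff: "\<And>p. \<forall>v\<in>range Inl. free_of v p \<Longrightarrow> p \<in> P0 \<longleftrightarrow> p \<in> P"
    and chain: "\<And>k. has_chain k P0 \<Longrightarrow> has_chain (k + card (- K)) P" by blast
  note id0 = prime_ideal_ideal[OF P0]
  \<comment> \<open>the linear forms in \<open>L\<close>, as relations among the variables \<open>x\<^sub>j\<close>\<close>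
  define h :: "'l \<Rightarrow> 'n + 'l \<Rightarrow> ('n + 'l) cpoly"
    where "h k e = (case e of Inl _ \<Rightarrow> 0 | Inr j \<Rightarrow> const (b k $ j))" for k e
  have "\<exists>P1. prime_ideal P1
    \<and> (\<forall>p. (\<forall>v\<in>range Inr. free_of v p) \<longrightarrow> (p \<in> P1 \<longleftrightarrow> p \<in> P0))
    \<and> (\<forall>k. has_chain k P1 \<longrightarrow> has_chain (k + card K) P0)"
  proof (rule chain_of_linear_relations[OF P0, of K "range Inr" h])
    fix k and w e :: "'n + 'l" assume "w \<in> range Inr" "e \<in> range Inr"
    then show "free_of w (h k e)" by (auto simp: h_def free_of_const)
  next
    fix k assume k: "k \<in> K"
    have "(\<Sum>e\<in>range Inr. h k e * var e) = incl (linear_form (b k))"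
      by (simp add: sum_Inr h_def linear_form_def incl_simps)
    moreover have "incl (linear_form (b k)) \<in> P0"
      using P0_iff free_of_incl bL[OF k] by (auto simp: L_def)
    ultimately show "(\<Sum>e\<in>range Inr. h k e * var e) \<in> P0" by simp
  next
    fix r k
    assume r: "\<And>e. e \<in> range Inr \<Longrightarrow> (\<Sum>j\<in>K. r j * h j e) \<in> P0" and k: "k \<in> K"
    have "r k = (\<Sum>j\<in>K. if j = k then r j else 0)" using k by (simp add: sum.delta)
    also have "\<dots> = (\<Sum>j\<in>K. r j * const (\<Sum>m\<in>UNIV. b j $ m * v k $ m))"
      by (rule sum.cong) (auto simp: dual)
    also have "\<dots> = (\<Sum>m\<in>UNIV. const (v k $ m) * (\<Sum>j\<in>K. r j * h j (Inr m)))"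
      unfolding const_sum const_mult sum_distrib_left h_def
      by (subst sum.swap) (simp add: mult_ac)
    also have "\<dots> \<in> P0" by (intro ideal_set_sum[OF id0] ideal_set_mult[OF id0] r) auto
    finally show "r k \<in> P0" .
  qed simp
  then obtain P1 :: "('n + 'l) cpoly set" where P1: "prime_ideal P1"
    "\<forall>k. has_chain k P1 \<longrightarrow> has_chain (k + card K) P0"
    by blast
  have "has_chain (0 + card K) P0" using P1(2) has_chain_0[OF P1(1)] by blast
  from chain[OF this] have "has_chain (card K + card (- K)) P" by simp
  moreover have "card K + card (- K) = CARD('l)"
    using card_Un_disjoint[of K "- K"] by simp
  ultimately show ?thesis by simp
qed

lemma growth_mono:
  assumes "P \<subseteq> P'" "growth d P'"
  shows "growth d P"
proof -
  have mono: "independent_mod P I w" if "independent_mod P' I w" for I :: "nat list set" and w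
    using that \<open>P \<subseteq> P'\<close> unfolding independent_mod_def by blast
  from assms(2) show ?thesis
    unfolding growth_def
    by (elim ex_forward all_forward conj_forward) (assumption | rule mono)+
qed

text \<open>
  Choose a basis among the forms, with indices in \<open>J\<close>, and express the others by it:
  \<open>f\<^sub>i = \<Sum>\<^sub>j c i j * f\<^sub>j\<close> with \<open>j\<close> in \<open>J\<close>. Clearing denominators by
  \<open>a\<^sub>i = f\<^sub>i * \<beta>\<^sub>i\<close>, the equation \<open>\<omega>\<^sub>a = 0\<close> over the complement of the
  arrangement becomes \<open>\<Sum>\<^sub>i \<beta>\<^sub>i * df\<^sub>i = 0\<close>, and its solutions have the \<open>\<beta>\<^sub>i\<close>
  with \<open>i\<close> outside \<open>J\<close> as free parameters. The kernel \<open>P\<close> of the resulting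
  parametrisation \<open>\<phi>\<close> is a prime containing the ideal, namely that of the closure of the
  set of these solutions. It depends on \<open>n\<close> parameters, including the \<open>x\<^sub>j\<close>, so at
  least \<open>n\<close> strict inclusions of primes lie above \<open>P\<close>, which leaves room for at most
  \<open>\<ell>\<close> below it.
\<close>

lemma log_ideal_small_prime:
  fixes f :: "'n::finite \<Rightarrow> complex ^ 'l::finite"
  assumes arr: "central_arrangement f" and ess: "essential f"
  obtains P where "prime_ideal P" "log_ideal f \<subseteq> P" "height P \<le> enat CARD('l)"
proof -
  obtain J where J: "card J = CARD('l)" "\<And>d. \<exists>k. d = (\<Sum>j\<in>J. k j *s f j)"
    using essential_basis[OF ess] by metis
  have "\<forall>i. \<exists>k. f i = (\<Sum>j\<in>J. k j *s f j)" using J(2) by simp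
  from choice[OF this] obtain c where c: "\<And>i. f i = (\<Sum>j\<in>J. c i j *s f j)" by blast
  define \<beta> :: "'n \<Rightarrow> ('n + 'l) cpoly"
    where "\<beta> i = (if i \<in> J then - (\<Sum>k\<in>- J. const (c k i) * var (Inl k)) else var (Inl i))" for i
  define \<phi> where "\<phi> = subst (\<lambda>w. case w of Inl i \<Rightarrow> incl (linear_form (f i)) * \<beta> i |
      Inr j \<Rightarrow> var (Inr j))"
  have hom: "comm_ring_hom \<phi>" unfolding \<phi>_def by (rule comm_ring_hom_subst)
  have \<phi>_const: "\<phi> (const a) = const a" for a by (simp add: \<phi>_def subst_simps)
  have \<phi>_Inl: "\<phi> (var (Inl i)) = incl (linear_form (f i)) * \<beta> i" for i
    by (simp add: \<phi>_def subst_simps)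
  have \<phi>_Inr: "\<phi> (var (Inr j)) = var (Inr j)" for j by (simp add: \<phi>_def subst_simps)
  have \<phi>_incl: "\<phi> (incl p) = incl p" for p
    by (rule comm_ring_hom_eqI[OF comm_ring_hom_comp[OF hom comm_ring_hom_incl] comm_ring_hom_incl])
      (auto simp: \<phi>_const \<phi>_Inr)
  define P where "P = \<phi> -` {0}"
  have P: "prime_ideal P" unfolding P_def by (rule prime_ideal_vimage[OF hom prime_ideal_zero])
  have "pairing f \<theta> \<in> P" if \<theta>: "\<theta> \<in> log_derivations f" for \<theta>
  proof -
    have der: "derivation \<theta>" using \<theta> by (simp add: log_derivations_iff)
    define t :: "'n \<Rightarrow> ('n + 'l) cpoly" where "t i = incl (\<theta> (linear_form (f i)))" for i
    have t: "t i = (\<Sum>j\<in>J. const (c i j) * t j)" for i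
      unfolding t_def
      by (subst c) (simp add: linear_form_sum linear_form_scale derivation_sum[OF der]
          derivation_scale[OF der] incl_simps)
    have "\<phi> (pairing f \<theta>) = (\<Sum>i\<in>UNIV. \<beta> i * incl (linear_form (f i) * log_quot f i \<theta>))"
      by (simp add: pairing_eq[OF arr] comm_ring_hom_sum[OF hom] comm_ring_hom_mult[OF hom] \<phi>_Inl \<phi>_incl
          incl_simps mult_ac)
    also have "\<dots> = (\<Sum>i\<in>UNIV. \<beta> i * t i)"
      by (simp add: log_quot_mult[OF arr \<theta>] t_def)
    also have "\<dots> = (\<Sum>i\<in>J. \<beta> i * t i) + (\<Sum>i\<in>- J. \<beta> i * t i)"
      using sum.union_disjoint[of J "- J" "\<lambda>i. \<beta> i * t i"] by simp
    also have "(\<Sum>i\<in>- J. \<beta> i * t i) = (\<Sum>i\<in>- J. var (Inl i) * (\<Sum>j\<in>J. const (c i j) * t j))"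
      by (rule sum.cong) (auto simp: \<beta>_def t[symmetric])
    also have "\<dots> = (\<Sum>j\<in>J. (\<Sum>i\<in>- J. const (c i j) * var (Inl i)) * t j)"
      unfolding sum_distrib_left sum_distrib_right
      by (subst sum.swap) (simp add: mult_ac)
    also have "\<dots> = (\<Sum>j\<in>J. - (\<beta> j * t j))"
      by (rule sum.cong) (auto simp: \<beta>_def)
    finally show ?thesis by (simp add: P_def sum_negf)
  qed
  then have "log_ideal f \<subseteq> P"
    unfolding log_ideal_def by (intro ideal_generated_minimal prime_ideal_ideal[OF P]) auto
  \<comment> \<open>a chain of \<open>n\<close> primes above \<open>P\<close>: bring the coordinates to life one after the other\<close>
  define \<zeta> where "\<zeta> T = subst (\<lambda>w. if w \<in> T then var w else 0)" for T :: "('n + 'l) set"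
  have hom\<zeta>: "comm_ring_hom (\<zeta> T)" for T unfolding \<zeta>_def by (rule comm_ring_hom_subst)
  have \<zeta>_const: "\<zeta> T (const a) = const a" and \<zeta>_var: "\<zeta> T (var w) = (if w \<in> T then var w else 0)"
    for T a w by (simp_all add: \<zeta>_def subst_simps)
  define K where "K T = (\<lambda>s. \<zeta> T (\<phi> s)) -` {0}" for T
  have K: "prime_ideal (K T)" for T
    unfolding K_def by (rule prime_ideal_vimage[OF comm_ring_hom_comp[OF hom\<zeta> hom]
        prime_ideal_zero])
  have \<zeta>\<zeta>: "\<zeta> T (\<zeta> (insert w T) s) = \<zeta> T s" for T w s
    by (rule comm_ring_hom_eqI[OF comm_ring_hom_comp[OF hom\<zeta> hom\<zeta>] hom\<zeta>])
      (auto simp: \<zeta>_const \<zeta>_var comm_ring_hom_0[OF hom\<zeta>])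
  have step: "growth (Suc d) (K (insert w T))"
    if "growth d (K T)" "\<zeta> T (\<phi> (var w)) = 0" "\<zeta> (insert w T) (\<phi> (var w)) \<noteq> 0" for d w T
  proof (rule growth_Suc[OF K K _ that(1)])
    have "K (insert w T) \<subseteq> K T"
    proof
      fix s assume "s \<in> K (insert w T)"
      then have "\<zeta> T (\<zeta> (insert w T) (\<phi> s)) = 0" by (simp add: K_def comm_ring_hom_0[OF hom\<zeta>])
      then show "s \<in> K T" by (simp add: K_def \<zeta>\<zeta>)
    qed
    then show "K (insert w T) \<subset> K T" using that by (auto simp: K_def)
  qed
  have var_neq_0: "var w \<noteq> (0 :: ('n + 'l) cpoly)" for w
    by (metis var_def lookup_single_eq lookup_zero zero_neq_one)
  have x: "growth (card V) (K (Inr ` V))" for V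
    using finite[of V]
  proof (induction V rule: finite_induct)
    case empty
    then show ?case using growth_0[OF K] by simp
  next
    case (insert j V)
    then have "growth (Suc (card V)) (K (insert (Inr j) (Inr ` V)))"
      by (intro step) (auto simp: \<phi>_Inr \<zeta>_var var_neq_0)
    then show ?case using insert by simp
  qed
  have \<zeta>_incl: "\<zeta> T (incl p) = incl p" if "\<And>j. Inr j \<in> T" for T p
    by (rule comm_ring_hom_eqI[OF comm_ring_hom_comp[OF hom\<zeta> comm_ring_hom_incl]
        comm_ring_hom_incl])
      (use that in \<open>auto simp: \<zeta>_const \<zeta>_var\<close>)
  have a: "growth (card W + CARD('l)) (K (Inl ` W \<union> range Inr))" if "W \<subseteq> - J" for W
    using finite[of W] that
  proof (induction W rule: finite_induct)
    case empty
    then show ?case using x[of UNIV] by simp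
  next
    case (insert i W)
    have "\<phi> (var (Inl i)) = incl (linear_form (f i)) * var (Inl i)"
      using insert.prems by (simp add: \<phi>_Inl \<beta>_def)
    then have "growth (Suc (card W + CARD('l))) (K (insert (Inl i) (Inl ` W \<union> range Inr)))"
      using insert
      by (intro step) (auto simp: comm_ring_hom_mult[OF hom\<zeta>] \<zeta>_incl \<zeta>_var var_neq_0 incl_eq_0_iff
          linear_form_neq_0[OF arr]
          cpoly_mult_eq_0_iff)
    then show ?case using insert by simp
  qed
  have "P \<subseteq> K T" for T by (auto simp: P_def K_def comm_ring_hom_0[OF hom\<zeta>])
  then have "growth (card (- J) + CARD('l)) P" using growth_mono a[of "- J"] by blast
  moreover have "card (- J) + CARD('l) = CARD('n)"
    using card_Un_disjoint[of J "- J"] J(1) by simp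
  ultimately have growth: "growth CARD('n) P" by simp
  have "height P \<le> enat CARD('l)"
  proof (rule height_le)
    fix k assume "has_chain k P"
    from has_chain_growth[OF this growth] show "k \<le> CARD('l)" by simp
  qed
  with P \<open>log_ideal f \<subseteq> P\<close> show thesis by (rule that)
qed

lemma codim_log_ideal:
  fixes f :: "'n::finite \<Rightarrow> complex ^ 'l::finite"
  assumes "central_arrangement f" and "essential f"
  shows "codim (log_ideal f) = enat CARD('l)"
proof (rule antisym)
  obtain P where P: "prime_ideal P" "log_ideal f \<subseteq> P" "height P \<le> enat CARD('l)"
    using log_ideal_small_prime[OF assms] .
  have "codim (log_ideal f) \<le> height P" unfolding codim_def by (rule Inf_lower) (use P in blast)
  then show "codim (log_ideal f) \<le> enat CARD('l)" using P(3) by (rule order_trans)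
  show "enat CARD('l) \<le> codim (log_ideal f)"
    unfolding codim_def
    by (rule Inf_greatest) (use has_chain_le_height has_chain_of_log_ideal_subset[OF assms] in blast)
qed

section \<open>Complete intersections and freeness\<close>

theorem theorem2p13:
  fixes f :: "'n::finite \<Rightarrow> complex ^ 'l::finite"
  assumes "central_arrangement f" and "essential f"
  shows "complete_intersection (log_ideal f) \<longleftrightarrow> free_arrangement f"
proof
  assume "complete_intersection (log_ideal f)"
  then obtain G where G: "finite G" "ideal_generated G = log_ideal f" "card G = CARD('l)"
    unfolding complete_intersection_def codim_log_ideal[OF assms] by auto
  from log_derivations_spanned_by_linear_parts[OF assms G(1,2)]
  obtain \<eta> where span: "maps.span (\<eta> ` G) = log_derivations f" .
  have "card (\<eta> ` G) \<le> CARD('l)" using card_image_le[OF G(1), of \<eta>] G(3) by simp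
  then have "maps.independent (\<eta> ` G)"
    using G(1) by (intro independent_of_spanning_card_le[OF assms(1) _ _ span]) simp_all
  with span show "free_arrangement f" unfolding free_arrangement_def free_submodule_def by blast
next
  assume "free_arrangement f"
  then obtain B where B: "maps.independent B" "maps.span B = log_derivations f"
    unfolding free_arrangement_def free_submodule_def by blast
  have BD: "b \<in> log_derivations f" if "b \<in> B" for b using B(2) maps.span_base[OF that] by blast
  have fin: "finite B" and le: "card B \<le> CARD('l)"
    using card_independent_derivations_le[OF B(1)] BD by (auto simp: log_derivations_iff)
  have "CARD('l) \<le> card B"
    by (rule card_ge_of_coordinate_derivations_in_span[OF fin
        defining_polynomial_neq_0[OF assms(1)]])
      (simp add: B(2) log_derivation_coordinate)
  with le have card: "card B = CARD('l)" by simp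
  have "inj_on (pairing f) B"
    using pairing_inj[OF assms] BD by (auto simp: inj_on_def)
  then have "card (pairing f ` B) = CARD('l)" using card by (simp add: card_image)
  moreover have "ideal_generated (pairing f ` B) = log_ideal f"
  proof
    show "ideal_generated (pairing f ` B) \<subseteq> log_ideal f"
      by (rule ideal_generated_minimal[OF ideal_log_ideal]) (use pairing_in_log_ideal BD in auto)
    have "pairing f \<theta> \<in> ideal_generated (pairing f ` B)" if "\<theta> \<in> log_derivations f" for \<theta>
    proof -
      have "\<theta> \<in> maps.span B" using that B(2) by simp
      then obtain r where "\<theta> = (\<Sum>b\<in>B. scale_map (r b) b)"
        unfolding maps.span_finite[OF fin] by blast
      then have "pairing f \<theta> = (\<Sum>b\<in>B. incl (r b) * pairing f b)"
        using pairing_sum[OF assms(1) BD] by simp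
      then show ?thesis
        by (simp add: ideal_set_sum ideal_set_mult ideal_generated_ideal ideal_generated_incl)
    qed
    then show "log_ideal f \<subseteq> ideal_generated (pairing f ` B)"
      unfolding log_ideal_def by (intro ideal_generated_minimal ideal_generated_ideal) auto
  qed
  ultimately show "complete_intersection (log_ideal f)"
    unfolding complete_intersection_def codim_log_ideal[OF assms] using fin by blast
qed

end
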